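(* Let $X$ be a separable Banach space. Then the following conditions are equivalent: (1) $X$ coarsely embeds into a Hilbert space; (2) $X$ uniformly embeds into a Hilbert space; (3) $X$ admits an uncollapsed uniformly continuous map into a Hilbert space; (4) $X$ has the Haagerup property.
   Context: For a map $\sigma\colon (X,d)\to (Y,\partial)$ between metric spaces put $\kappa_\sigma(t)=\inf\{\partial(\sigma(a),\sigma(b)) : d(a,b)\geqslant t\}$ (compression modulus) and $\theta_\sigma(t)=\sup\{\partial(\sigma(a),\sigma(b)) : d(a,b)\leqslant t\}$ (expansion modulus). The map $\sigma$ is uniformly continuous if $\lim_{t\to 0_+}\theta_\sigma(t)=0$; a uniform embedding if it is uniformly continuous and $\kappa_\sigma(t)>0$ for all $t>0$; bornologous if $\theta_\sigma(t)<\infty$ for all $t<\infty$; expanding if $\lim_{t\to\infty}\kappa_\sigma(t)=\infty$; a coarse embedding if it is bornologous and expanding; uncollapsed if $\kappa_\sigma(t)>0$ for some $t>0$. Banach spaces carry their norm metric. $X$ is also viewed as the topological group $(X,+)$ with the norm topology. It has the Haagerup property if it admits a coarsely proper continuous affine isometric action on a Hilbert space, i.e. if there are a Hilbert space $\mathcal H$, a strongly continuous isometric linear representation $\pi$ of the group $(X,+)$ on $\mathcal H$ and a continuous map $b\colon X\to\mathcal H$ with $b(x+y)=\pi(x)b(y)+b(x)$ for all $x,y\in X$ such that $b$ is a coarse embedding. *)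

theory Defs
  imports "HOL-Analysis.Analysis"
begin

section \<open>The Hilbert space of square-summable families\<close>

text \<open>
  The type \<open>'i ell2\<close> is the real Hilbert space of square-summable families indexed by \<open>'i\<close>.
  It serves as a concrete Hilbert space of orthonormal dimension the cardinality of \<open>'i\<close>, since
  an existential quantifier over Hilbert spaces cannot range over types.
\<close>

typedef 'i ell2 = "{f :: 'i \<Rightarrow> real. (\<lambda>i. (f i)\<^sup>2) summable_on UNIV}"
  morphisms ell2_nth Abs_ell2
  by (rule exI[of _ "\<lambda>_. 0"]) simp

setup_lifting type_definition_ell2

lemma square_summable_mult:
  fixes f g :: "'i \<Rightarrow> real"
  assumes "(\<lambda>i. (f i)\<^sup>2) summable_on UNIV" "(\<lambda>i. (g i)\<^sup>2) summable_on UNIV"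
  shows "(\<lambda>i. f i * g i) summable_on UNIV"
proof (rule abs_summable_summable, rule summable_on_comparison_test)
  show "(\<lambda>i. (f i)\<^sup>2 + (g i)\<^sup>2) summable_on UNIV"
    using assms by (rule summable_on_add)
next
  fix i
  have "0 \<le> (\<bar>f i\<bar> - \<bar>g i\<bar>)\<^sup>2" by simp
  then have "2 * (\<bar>f i\<bar> * \<bar>g i\<bar>) \<le> (f i)\<^sup>2 + (g i)\<^sup>2"
    by (simp add: power2_diff)
  moreover have "0 \<le> \<bar>f i\<bar> * \<bar>g i\<bar>" by simp
  ultimately show "norm (f i * g i) \<le> (f i)\<^sup>2 + (g i)\<^sup>2"
    unfolding real_norm_def abs_mult by linarith
qed simp

lemma square_summable_add:
  fixes f g :: "'i \<Rightarrow> real"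
  assumes "(\<lambda>i. (f i)\<^sup>2) summable_on UNIV" "(\<lambda>i. (g i)\<^sup>2) summable_on UNIV"
  shows "(\<lambda>i. (f i + g i)\<^sup>2) summable_on UNIV"
proof -
  have "(\<lambda>i. ((f i)\<^sup>2 + (g i)\<^sup>2) + 2 * (f i * g i)) summable_on UNIV"
    by (intro summable_on_add summable_on_cmult_right square_summable_mult assms)
  then show ?thesis by (simp add: power2_sum mult.assoc)
qed

lemma square_summable_scale:
  fixes f :: "'i \<Rightarrow> real"
  assumes "(\<lambda>i. (f i)\<^sup>2) summable_on UNIV"
  shows "(\<lambda>i. (c * f i)\<^sup>2) summable_on UNIV"
  using summable_on_cmult_right[OF assms, of "c\<^sup>2"] by (simp add: power_mult_distrib)

instantiation ell2 :: (type) real_inner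
begin

lift_definition zero_ell2 :: "'i ell2" is "\<lambda>_. 0" by simp

lift_definition plus_ell2 :: "'i ell2 \<Rightarrow> 'i ell2 \<Rightarrow> 'i ell2" is "\<lambda>f g i. f i + g i"
  by (rule square_summable_add)

lift_definition uminus_ell2 :: "'i ell2 \<Rightarrow> 'i ell2" is "\<lambda>f i. - f i" by simp

lift_definition minus_ell2 :: "'i ell2 \<Rightarrow> 'i ell2 \<Rightarrow> 'i ell2" is "\<lambda>f g i. f i - g i"
  subgoal for f g using square_summable_add[of f "\<lambda>i. - g i"] by simp
  done

lift_definition scaleR_ell2 :: "real \<Rightarrow> 'i ell2 \<Rightarrow> 'i ell2" is "\<lambda>c f i. c * f i"
  by (rule square_summable_scale)

lift_definition inner_ell2 :: "'i ell2 \<Rightarrow> 'i ell2 \<Rightarrow> real" is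
  "\<lambda>f g. \<Sum>\<^sub>\<infinity>i. f i * g i" .

definition norm_ell2 :: "'i ell2 \<Rightarrow> real" where "norm_ell2 x = sqrt (inner x x)"

definition sgn_ell2 :: "'i ell2 \<Rightarrow> 'i ell2" where "sgn_ell2 x = scaleR (inverse (norm x)) x"

definition dist_ell2 :: "'i ell2 \<Rightarrow> 'i ell2 \<Rightarrow> real" where "dist_ell2 x y = norm (x - y)"

definition uniformity_ell2 :: "('i ell2 \<times> 'i ell2) filter" where
  "uniformity_ell2 = (INF e\<in>{0<..}. principal {(x, y). dist x y < e})"

definition open_ell2 :: "'i ell2 set \<Rightarrow> bool" where
  "open_ell2 U = (\<forall>x\<in>U. eventually (\<lambda>(x', y). x' = x \<longrightarrow> y \<in> U) uniformity)"

instance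
proof
  fix x y z :: "'i ell2" and a b :: real
  show "x + y + z = x + (y + z)" by transfer (simp add: add.assoc)
  show "x + y = y + x" by transfer (simp add: add.commute)
  show "0 + x = x" by transfer simp
  show "- x + x = 0" by transfer simp
  show "x - y = x + - y" by transfer simp
  show "a *\<^sub>R (x + y) = a *\<^sub>R x + a *\<^sub>R y" by transfer (simp add: distrib_left)
  show "(a + b) *\<^sub>R x = a *\<^sub>R x + b *\<^sub>R x" by transfer (simp add: distrib_right)
  show "a *\<^sub>R b *\<^sub>R x = (a * b) *\<^sub>R x" by transfer (simp add: mult.assoc)
  show "1 *\<^sub>R x = x" by transfer simp
  show "inner x y = inner y x" by transfer (simp add: mult.commute)
  show "inner (x + y) z = inner x z + inner y z"
    by transfer (simp add: distrib_right infsum_add square_summable_mult)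
  show "inner (a *\<^sub>R x) y = a * inner x y"
    by transfer (simp add: mult.assoc infsum_cmult_right')
  show "0 \<le> inner x x" by transfer (simp add: infsum_nonneg)
  show "inner x x = 0 \<longleftrightarrow> x = 0"
  proof transfer
    fix f :: "'i \<Rightarrow> real"
    assume f: "(\<lambda>i. (f i)\<^sup>2) summable_on UNIV"
    show "(\<Sum>\<^sub>\<infinity>i. f i * f i) = 0 \<longleftrightarrow> f = (\<lambda>_. 0)"
    proof
      assume "(\<Sum>\<^sub>\<infinity>i. f i * f i) = 0"
      then have "(f i)\<^sup>2 = 0" for i
        by (intro nonneg_infsum_le_0D[OF _ f]) (simp_all add: power2_eq_square)
      then show "f = (\<lambda>_. 0)" by auto
    qed simp
  qed
qed (simp_all only: norm_ell2_def sgn_ell2_def dist_ell2_def uniformity_ell2_def open_ell2_def)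

end

lemma ell2_sum_le:
  assumes "finite F" shows "(\<Sum>i\<in>F. (ell2_nth x i)\<^sup>2) \<le> (norm x)\<^sup>2"
proof -
  have "(norm x)\<^sup>2 = (\<Sum>\<^sub>\<infinity>i. (ell2_nth x i)\<^sup>2)"
    unfolding power2_norm_eq_inner inner_ell2.rep_eq by (simp add: power2_eq_square)
  moreover have "(\<lambda>i. (ell2_nth x i)\<^sup>2) summable_on UNIV"
    using ell2_nth[of x] by simp
  ultimately show ?thesis
    using finite_sum_le_infsum[of "\<lambda>i. (ell2_nth x i)\<^sup>2" UNIV F] assms by simp
qed

instance ell2 :: (type) complete_space
proof
  fix X :: "nat \<Rightarrow> 'i ell2"
  assume X: "Cauchy X"
  have partial: "(\<Sum>i\<in>F. (ell2_nth (X m) i - ell2_nth (X n) i)\<^sup>2) \<le> (norm (X m - X n))\<^sup>2"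
    if "finite F" for F m n
    using ell2_sum_le[OF that, of "X m - X n"] by (simp add: minus_ell2.rep_eq)
  have "convergent (\<lambda>n. ell2_nth (X n) i)" for i
  proof (rule Cauchy_convergent, rule metric_CauchyI)
    fix e :: real assume "0 < e"
    then obtain M where M: "\<forall>m\<ge>M. \<forall>n\<ge>M. dist (X m) (X n) < e"
      using metric_CauchyD[OF X \<open>0 < e\<close>] by blast
    have "dist (ell2_nth (X m) i) (ell2_nth (X n) i) < e" if "m \<ge> M" "n \<ge> M" for m n
    proof -
      have "\<bar>ell2_nth (X m) i - ell2_nth (X n) i\<bar> \<le> norm (X m - X n)"
      proof (rule power2_le_imp_le)
        show "\<bar>ell2_nth (X m) i - ell2_nth (X n) i\<bar>\<^sup>2 \<le> (norm (X m - X n))\<^sup>2"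
          using partial[of "{i}" m n] by simp
      qed simp
      moreover have "norm (X m - X n) < e" using M that by (metis dist_norm)
      ultimately show ?thesis by (simp add: dist_real_def)
    qed
    then show "\<exists>M. \<forall>m\<ge>M. \<forall>n\<ge>M. dist (ell2_nth (X m) i) (ell2_nth (X n) i) < e" by blast
  qed
  then obtain g where g: "\<And>i. (\<lambda>n. ell2_nth (X n) i) \<longlonglongrightarrow> g i"
    unfolding convergent_def by metis
  have bound: "(\<Sum>i\<in>F. (ell2_nth (X m) i - g i)\<^sup>2) \<le> e\<^sup>2"
    if "finite F" "m \<ge> M" "\<forall>m\<ge>M. \<forall>n\<ge>M. dist (X m) (X n) < e" for F m M e
  proof (rule LIMSEQ_le_const2)
    show "(\<lambda>n. \<Sum>i\<in>F. (ell2_nth (X m) i - ell2_nth (X n) i)\<^sup>2)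
        \<longlonglongrightarrow> (\<Sum>i\<in>F. (ell2_nth (X m) i - g i)\<^sup>2)"
      by (intro tendsto_sum tendsto_power tendsto_diff tendsto_const g)
    show "\<exists>N. \<forall>n\<ge>N. (\<Sum>i\<in>F. (ell2_nth (X m) i - ell2_nth (X n) i)\<^sup>2) \<le> e\<^sup>2"
    proof (intro exI allI impI)
      fix n assume "n \<ge> M"
      then have "norm (X m - X n) \<le> e" using that by (metis dist_norm less_imp_le)
      then show "(\<Sum>i\<in>F. (ell2_nth (X m) i - ell2_nth (X n) i)\<^sup>2) \<le> e\<^sup>2"
        using partial[OF that(1), of m n] power_mono[of "norm (X m - X n)" e 2] by simp
    qed
  qed
  have diff: "(\<lambda>i. (ell2_nth (X m) i - g i)\<^sup>2) summable_on UNIV"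
    if "m \<ge> M" "\<forall>m\<ge>M. \<forall>n\<ge>M. dist (X m) (X n) < e" for m M e
    by (rule nonneg_bdd_above_summable_on) (auto intro!: bdd_aboveI bound[OF _ that])
  obtain M where M: "\<forall>m\<ge>M. \<forall>n\<ge>M. dist (X m) (X n) < 1"
    using metric_CauchyD[OF X zero_less_one] by blast
  have "(\<lambda>i. (g i)\<^sup>2) summable_on UNIV"
  proof -
    have *: "(\<lambda>i. (- (ell2_nth (X M) i - g i))\<^sup>2) summable_on UNIV"
      using diff[OF order_refl M] by (simp only: power2_minus)
    have "(\<lambda>i. (ell2_nth (X M) i)\<^sup>2) summable_on UNIV" using ell2_nth[of "X M"] by simp
    from square_summable_add[OF this *] show ?thesis by simp
  qed
  then have G: "ell2_nth (Abs_ell2 g) = g" by (simp add: Abs_ell2_inverse)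
  have "X \<longlonglongrightarrow> Abs_ell2 g"
  proof (rule metric_LIMSEQ_I)
    fix e :: real assume e: "0 < e"
    then obtain M where M: "\<forall>m\<ge>M. \<forall>n\<ge>M. dist (X m) (X n) < e / 2"
      using metric_CauchyD[OF X half_gt_zero[OF e]] by blast
    have "dist (X m) (Abs_ell2 g) < e" if m: "m \<ge> M" for m
    proof -
      have "(norm (X m - Abs_ell2 g))\<^sup>2 = (\<Sum>\<^sub>\<infinity>i. (ell2_nth (X m) i - g i)\<^sup>2)"
        unfolding power2_norm_eq_inner inner_ell2.rep_eq minus_ell2.rep_eq G
        by (simp add: power2_eq_square)
      also have "\<dots> \<le> (e / 2)\<^sup>2"
        by (rule infsum_le_finite_sums[OF diff[OF m M]]) (rule bound[OF _ m M])
      finally have "norm (X m - Abs_ell2 g) \<le> e / 2"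
        using e by (simp add: power2_le_iff_abs_le)
      then show ?thesis using e by (simp add: dist_norm)
    qed
    then show "\<exists>M. \<forall>m\<ge>M. dist (X m) (Abs_ell2 g) < e" by blast
  qed
  then show "convergent X" by (rule convergentI)
qed

instance ell2 :: (type) banach ..


section \<open>Moduli of maps between metric spaces\<close>

text \<open>
  Both moduli take values in the extended reals, so that an infimum over the empty set is
  \<open>\<infinity>\<close> and a supremum over an unbounded set is \<open>\<infinity>\<close>.
\<close>

definition compression_modulus ::
  "('a::metric_space \<Rightarrow> 'b::metric_space) \<Rightarrow> real \<Rightarrow> ereal" where
  "compression_modulus \<sigma> t = Inf {ereal (dist (\<sigma> a) (\<sigma> b)) | a b. dist a b \<ge> t}"

definition expansion_modulus ::
  "('a::metric_space \<Rightarrow> 'b::metric_space) \<Rightarrow> real \<Rightarrow> ereal" where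
  "expansion_modulus \<sigma> t = Sup {ereal (dist (\<sigma> a) (\<sigma> b)) | a b. dist a b \<le> t}"

lemma uniformly_continuous_on_iff_expansion_modulus:
  "uniformly_continuous_on UNIV \<sigma> \<longleftrightarrow> (expansion_modulus \<sigma> \<longlongrightarrow> 0) (at_right 0)"
proof
  assume lim: "(expansion_modulus \<sigma> \<longlongrightarrow> 0) (at_right 0)"
  show "uniformly_continuous_on UNIV \<sigma>"
    unfolding uniformly_continuous_on_def
  proof (intro allI impI)
    fix e :: real assume "0 < e"
    then have "eventually (\<lambda>t. expansion_modulus \<sigma> t < ereal e) (at_right 0)"
      using order_tendstoD(2)[OF lim, of "ereal e"] by simp
    then obtain d where d: "d > 0" "\<And>t. 0 < t \<Longrightarrow> t < d \<Longrightarrow> expansion_modulus \<sigma> t < ereal e"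
      unfolding eventually_at_right_field by auto
    have "dist (\<sigma> y) (\<sigma> x) < e" if "dist y x < d / 2" for x y
    proof -
      have "ereal (dist (\<sigma> y) (\<sigma> x)) \<le> expansion_modulus \<sigma> (d / 2)"
        unfolding expansion_modulus_def using that by (intro Sup_upper) force
      also have "\<dots> < ereal e" using d by simp
      finally show ?thesis by simp
    qed
    then show "\<exists>d>0. \<forall>x\<in>UNIV. \<forall>x'\<in>UNIV. dist x' x < d \<longrightarrow> dist (\<sigma> x') (\<sigma> x) < e"
      using d(1) by (intro exI[of _ "d / 2"]) auto
  qed
next
  assume uc: "uniformly_continuous_on UNIV \<sigma>"
  have nonneg: "0 \<le> expansion_modulus \<sigma> t" if "0 < t" for t
  proof -
    have "ereal (dist (\<sigma> undefined) (\<sigma> undefined)) \<le> expansion_modulus \<sigma> t"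
      unfolding expansion_modulus_def using that by (intro Sup_upper) force
    then show ?thesis by (simp add: zero_ereal_def)
  qed
  show "(expansion_modulus \<sigma> \<longlongrightarrow> 0) (at_right 0)"
  proof (rule order_tendstoI)
    fix l :: ereal assume "l < 0"
    then show "eventually (\<lambda>t. l < expansion_modulus \<sigma> t) (at_right 0)"
      unfolding eventually_at_right_field
      by (intro exI[of _ 1]) (use nonneg less_le_trans in auto)
  next
    fix u :: ereal assume "0 < u"
    then obtain e where e: "0 < ereal e" "ereal e < u" using ereal_dense2 by blast
    then obtain d where d: "d > 0" "\<And>x y. dist y x < d \<Longrightarrow> dist (\<sigma> y) (\<sigma> x) < e"
      using uc unfolding uniformly_continuous_on_def by auto
    have "expansion_modulus \<sigma> t < u" if "0 < t" "t < d" for t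
    proof -
      have "expansion_modulus \<sigma> t \<le> ereal e"
        unfolding expansion_modulus_def
      proof (rule Sup_least, clarify)
        fix a b :: 'a assume "dist a b \<le> t"
        then have "dist (\<sigma> a) (\<sigma> b) < e" using d(2)[of a b] that by simp
        then show "ereal (dist (\<sigma> a) (\<sigma> b)) \<le> ereal e" by simp
      qed
      then show ?thesis using e by simp
    qed
    then show "eventually (\<lambda>t. expansion_modulus \<sigma> t < u) (at_right 0)"
      unfolding eventually_at_right_field using d(1) by auto
  qed
qed

definition uniform_embedding :: "('a::metric_space \<Rightarrow> 'b::metric_space) \<Rightarrow> bool" where
  "uniform_embedding \<sigma> \<longleftrightarrow>
     uniformly_continuous_on UNIV \<sigma> \<and> (\<forall>t>0. compression_modulus \<sigma> t > 0)"

definition bornologous :: "('a::metric_space \<Rightarrow> 'b::metric_space) \<Rightarrow> bool" where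
  "bornologous \<sigma> \<longleftrightarrow> (\<forall>t. expansion_modulus \<sigma> t < \<infinity>)"

definition expanding :: "('a::metric_space \<Rightarrow> 'b::metric_space) \<Rightarrow> bool" where
  "expanding \<sigma> \<longleftrightarrow> (compression_modulus \<sigma> \<longlongrightarrow> \<infinity>) at_top"

definition coarse_embedding :: "('a::metric_space \<Rightarrow> 'b::metric_space) \<Rightarrow> bool" where
  "coarse_embedding \<sigma> \<longleftrightarrow> bornologous \<sigma> \<and> expanding \<sigma>"

definition uncollapsed :: "('a::metric_space \<Rightarrow> 'b::metric_space) \<Rightarrow> bool" where
  "uncollapsed \<sigma> \<longleftrightarrow> (\<exists>t>0. compression_modulus \<sigma> t > 0)"

section \<open>The four conditions for a given target space\<close>

text \<open>
  Each condition is stated for maps into, or affine actions on, the type \<open>'h\<close>;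
  the real Hilbert spaces are the types of sort \<open>{real_inner, banach}\<close>.
\<close>

definition coarsely_embeds :: "'a::metric_space itself \<Rightarrow> 'h::metric_space itself \<Rightarrow> bool" where
  "coarsely_embeds _ _ \<longleftrightarrow> (\<exists>\<sigma> :: 'a \<Rightarrow> 'h. coarse_embedding \<sigma>)"

definition uniformly_embeds :: "'a::metric_space itself \<Rightarrow> 'h::metric_space itself \<Rightarrow> bool" where
  "uniformly_embeds _ _ \<longleftrightarrow> (\<exists>\<sigma> :: 'a \<Rightarrow> 'h. uniform_embedding \<sigma>)"

definition admits_uncollapsed_uc_map ::
  "'a::metric_space itself \<Rightarrow> 'h::metric_space itself \<Rightarrow> bool" where
  "admits_uncollapsed_uc_map _ _ \<longleftrightarrow>
     (\<exists>\<sigma> :: 'a \<Rightarrow> 'h. uncollapsed \<sigma> \<and> uniformly_continuous_on UNIV \<sigma>)"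

text \<open>
  Each \<open>\<pi> x\<close> is a linear isometry; it is automatically surjective, with inverse \<open>\<pi> (- x)\<close>.
\<close>

definition isometric_representation ::
  "('a::real_normed_vector \<Rightarrow> 'h::real_normed_vector \<Rightarrow> 'h) \<Rightarrow> bool" where
  "isometric_representation \<pi> \<longleftrightarrow>
     (\<forall>x. linear (\<pi> x) \<and> (\<forall>v. norm (\<pi> x v) = norm v)) \<and>
     \<pi> 0 = id \<and> (\<forall>x y. \<pi> (x + y) = \<pi> x \<circ> \<pi> y)"

definition strongly_continuous ::
  "('a::topological_space \<Rightarrow> 'h::topological_space \<Rightarrow> 'h) \<Rightarrow> bool" where
  "strongly_continuous \<pi> \<longleftrightarrow> (\<forall>v. continuous_on UNIV (\<lambda>x. \<pi> x v))"

text \<open>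
  The pair of \<open>\<pi>\<close> and the cocycle \<open>b\<close> encodes the affine isometric action in which \<open>x\<close> maps
  \<open>v\<close> to \<open>\<pi> x v + b x\<close>.
\<close>

definition haagerup_on ::
  "'a::real_normed_vector itself \<Rightarrow> 'h::{real_inner, banach} itself \<Rightarrow> bool" where
  "haagerup_on _ _ \<longleftrightarrow>
     (\<exists>(\<pi> :: 'a \<Rightarrow> 'h \<Rightarrow> 'h) (b :: 'a \<Rightarrow> 'h).
        isometric_representation \<pi> \<and> strongly_continuous \<pi> \<and>
        continuous_on UNIV b \<and> (\<forall>x y. b (x + y) = \<pi> x (b y) + b x) \<and>
        coarse_embedding b)"


section \<open>The conditions for an unspecified Hilbert space\<close>

text \<open>
  A map from \<open>'a\<close> into a Hilbert space takes its values in the closed linear span of its range,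
  and the linear part of an affine isometric action leaves the closed linear span of its cocycle
  invariant. When \<open>'a\<close> is infinite, this span has orthonormal dimension at most the cardinality of
  \<open>'a\<close>, hence embeds into \<open>'a ell2\<close>; on the complement the representation is extended by the
  identity. When \<open>'a\<close> is trivial, all conditions hold. So \<open>'a ell2\<close> is large enough to witness
  the existence of a Hilbert space.
\<close>

definition coarsely_embeds_into_Hilbert :: "'a::real_normed_vector itself \<Rightarrow> bool" where
  "coarsely_embeds_into_Hilbert X \<longleftrightarrow> coarsely_embeds X TYPE('a ell2)"

definition uniformly_embeds_into_Hilbert :: "'a::real_normed_vector itself \<Rightarrow> bool" where
  "uniformly_embeds_into_Hilbert X \<longleftrightarrow> uniformly_embeds X TYPE('a ell2)"

definition admits_uncollapsed_uc_map_into_Hilbert ::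
  "'a::real_normed_vector itself \<Rightarrow> bool" where
  "admits_uncollapsed_uc_map_into_Hilbert X \<longleftrightarrow> admits_uncollapsed_uc_map X TYPE('a ell2)"

definition haagerup :: "'a::real_normed_vector itself \<Rightarrow> bool" where
  "haagerup X \<longleftrightarrow> haagerup_on X TYPE('a ell2)"

end

theory Submission
  imports Defs
begin

text \<open>
  Averaging \<open>\<parallel>\<sigma>(x + z) - \<sigma>(z)\<parallel>\<^sup>2\<close> over \<open>z\<close> by an invariant mean of the abelian group \<open>(X, +)\<close> turns a map
  \<open>\<sigma>\<close> into a Hilbert space into a function \<open>\<psi>\<close> of negative type on \<open>X\<close> lying between
  \<open>\<kappa>\<^sub>\<sigma>(\<parallel>x\<parallel>)\<^sup>2\<close> and \<open>\<theta>\<^sub>\<sigma>(\<parallel>x\<parallel>)\<^sup>2\<close>. If \<open>\<sigma>\<close> is uniformly continuous, then so is \<open>\<psi>\<close>; if \<open>\<sigma>\<close> is only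
  bornologous, the base point \<open>\<sigma>\<close> of its translation orbit is replaced by a limit of Chebyshev centres
  of small pieces of the orbit, which makes the orbit continuous and changes \<open>\<surd>\<psi>\<close> by a bounded
  amount only. A \<open>\<psi>\<close> bounded below outside a ball becomes proper by summing dilations
  \<open>\<psi>(\<lambda>\<^sub>n x)\<close> with \<open>\<lambda>\<^sub>n \<rightarrow> 0\<close>, and a proper one separates points uniformly after summing the dilations
  \<open>8\<^sup>-\<^sup>n \<psi>(2\<^sup>n x)\<close>. Finally, the GNS construction for a continuous \<open>\<psi>\<close> of negative type, carried out
  on a dense sequence of \<open>X\<close>, gives a map \<open>b\<close> with \<open>\<parallel>b(x) - b(y)\<parallel>\<^sup>2 = \<psi>(x - y)\<close>, and this map is a cocycle
  for an isometric representation of \<open>X\<close>.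
\<close>

section \<open>Invariant means\<close>

text \<open>Integration against a finitely additive probability measure. \<open>M\<close> is a total
  functional, so the general clauses speak of bounded functions and leave the values elsewhere
  arbitrary.\<close>

definition is_mean :: "(('a \<Rightarrow> real) \<Rightarrow> real) \<Rightarrow> bool" where
  "is_mean M \<longleftrightarrow>
     (\<forall>f g. bounded (range f) \<longrightarrow> bounded (range g) \<longrightarrow> M (\<lambda>z. f z + g z) = M f + M g) \<and>
     (\<forall>c f. bounded (range f) \<longrightarrow> M (\<lambda>z. c * f z) = c * M f) \<and>
     (\<forall>f. bounded (range f) \<longrightarrow> (\<forall>z. 0 \<le> f z) \<longrightarrow> 0 \<le> M f) \<and>
     M (\<lambda>_. 1) = 1"

lemma is_meanD:
  assumes "is_mean M"
  shows mean_add: "\<lbrakk>bounded (range f); bounded (range g)\<rbrakk> \<Longrightarrow> M (\<lambda>z. f z + g z) = M f + M g"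
    and mean_cmult: "bounded (range f) \<Longrightarrow> M (\<lambda>z. c * f z) = c * M f"
    and mean_nonneg: "\<lbrakk>bounded (range f); \<And>z. 0 \<le> f z\<rbrakk> \<Longrightarrow> 0 \<le> M f"
    and mean_one: "M (\<lambda>_. 1) = 1"
  using assms unfolding is_mean_def by blast+

lemma bounded_range_add [intro]:
  fixes f g :: "'a \<Rightarrow> 'b::real_normed_vector"
  shows "\<lbrakk>bounded (range f); bounded (range g)\<rbrakk> \<Longrightarrow> bounded (range (\<lambda>z. f z + g z))"
  by (rule bounded_plus_comp)

lemma bounded_range_diff [intro]:
  fixes f g :: "'a \<Rightarrow> 'b::real_normed_vector"
  shows "\<lbrakk>bounded (range f); bounded (range g)\<rbrakk> \<Longrightarrow> bounded (range (\<lambda>z. f z - g z))"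
  by (rule bounded_minus_comp)

lemma bounded_range_cmult [intro]:
  fixes f :: "'a \<Rightarrow> real"
  assumes "bounded (range f)" shows "bounded (range (\<lambda>z. c * f z))"
  using bounded_scaleR_comp[OF assms, of c] by simp

lemma bounded_range_sum [intro]:
  fixes f :: "'i \<Rightarrow> 'a \<Rightarrow> 'b::real_normed_vector"
  assumes "\<And>i. i \<in> I \<Longrightarrow> bounded (range (f i))"
  shows "bounded (range (\<lambda>z. \<Sum>i\<in>I. f i z))"
  using assms by (induction I rule: infinite_finite_induct) (auto intro!: bounded_range_add)

lemma bounded_range_inner [intro]:
  fixes f g :: "'a \<Rightarrow> 'h::real_inner"
  assumes "bounded (range f)" "bounded (range g)"
  shows "bounded (range (\<lambda>z. inner (f z) (g z)))"
proof -
  obtain A B where A: "\<And>z. norm (f z) \<le> A" and B: "\<And>z. norm (g z) \<le> B"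
    using assms unfolding bounded_iff by auto
  have "norm (inner (f z) (g z)) \<le> A * B" for z
    using Cauchy_Schwarz_ineq2[of "f z" "g z"] mult_mono[OF A[of z] B[of z]] A[of z]
    by (smt (verit) norm_ge_zero real_norm_def)
  then show ?thesis unfolding bounded_iff by blast
qed

lemma bounded_range_norm_sq [intro]:
  fixes f :: "'a \<Rightarrow> 'h::real_inner"
  assumes "bounded (range f)" shows "bounded (range (\<lambda>z. (norm (f z))\<^sup>2))"
  using bounded_range_inner[OF assms assms] by (simp add: power2_norm_eq_inner)

lemma bounded_range_shift:
  "bounded (range f) \<Longrightarrow> bounded (range (\<lambda>z. f (z + h)))"
  by (rule bounded_subset) auto

lemma mean_const: "is_mean M \<Longrightarrow> M (\<lambda>_. c) = c"
  using mean_cmult[of M "\<lambda>_. 1" c] by (simp add: mean_one)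

lemma mean_diff:
  assumes "is_mean M" "bounded (range f)" "bounded (range g)"
  shows "M (\<lambda>z. f z - g z) = M f - M g"
proof -
  have "M (\<lambda>z. f z + (- 1) * g z) = M f + (- 1) * M g"
    using mean_add[OF assms(1,2) bounded_range_cmult[OF assms(3)], of "- 1"]
      mean_cmult[OF assms(1,3), of "- 1"] by simp
  then show ?thesis by simp
qed

lemma mean_mono:
  assumes "is_mean M" "bounded (range f)" "bounded (range g)" "\<And>z. f z \<le> g z"
  shows "M f \<le> M g"
  using mean_nonneg[OF assms(1) bounded_range_diff[OF assms(3,2)]] mean_diff[OF assms(1,3,2)] assms(4)
  by simp

lemma mean_abs_le:
  assumes "is_mean M" "\<And>z. \<bar>f z\<bar> \<le> B"
  shows "\<bar>M f\<bar> \<le> B"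
proof -
  have b: "bounded (range f)" using assms(2) unfolding bounded_iff by auto
  have "M f \<le> M (\<lambda>_. B)" "M (\<lambda>_. - B) \<le> M f"
    using assms(2) by (auto intro!: mean_mono[OF assms(1)] b simp: abs_le_iff minus_le_iff)
  then show ?thesis by (simp add: mean_const[OF assms(1)] abs_le_iff)
qed

lemma mean_sum:
  assumes "is_mean M" "\<And>i. i \<in> I \<Longrightarrow> bounded (range (f i))"
  shows "M (\<lambda>z. \<Sum>i\<in>I. f i z) = (\<Sum>i\<in>I. M (f i))"
  using assms(2)
  by (induction I rule: infinite_finite_induct)
     (auto simp: mean_const[OF assms(1)] mean_add[OF assms(1)] bounded_range_sum)

lemma bounded_real_range_iff: "bounded (range (f :: 'a \<Rightarrow> real)) \<longleftrightarrow> (\<exists>B. \<forall>z. \<bar>f z\<bar> \<le> B)"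
  unfolding bounded_iff by auto

text \<open>Means are normalised to vanish on unbounded functions, so that they form a closed subset of a
  product of compact intervals.\<close>

lemma compact_means:
  "compact {M :: ('a \<Rightarrow> real) \<Rightarrow> real. is_mean M \<and> (\<forall>f. \<not> bounded (range f) \<longrightarrow> M f = 0)}"
    (is "compact ?K")
proof -
  define bd where "bd f = (if bounded (range f) then SOME B. \<forall>z. \<bar>f z\<bar> \<le> B else 0)" for f :: "'a \<Rightarrow> real"
  have bd: "\<bar>f z\<bar> \<le> bd f" if "bounded (range f)" for f z
    using someI_ex[of "\<lambda>B. \<forall>z. \<bar>f z\<bar> \<le> B"] that by (auto simp: bd_def bounded_real_range_iff)
  let ?P = "PiE UNIV (\<lambda>f. {- bd f .. bd f})"
  have "compact ?P"
    using compactin_PiE[of "\<lambda>_. euclideanreal" UNIV "\<lambda>f. {- bd f .. bd f}"]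
    by (simp add: euclidean_product_topology)
  \<comment> \<open>Each clause of \<open>is_mean\<close> involves only finitely many coordinates of
    \<open>M\<close>, and boundedness of \<open>f\<close> does not depend on \<open>M\<close>, so
    the set is closed in the product topology.\<close>
  moreover have "closed ?K"
    unfolding is_mean_def
    by (intro closed_Collect_conj closed_Collect_all closed_Collect_imp closed_Collect_eq
        closed_Collect_le open_Collect_const continuous_on_product_coordinates continuous_intros)
  moreover have "M f \<in> {- bd f .. bd f}" if "M \<in> ?K" for M f
  proof (cases "bounded (range f)")
    case True
    then have "\<bar>M f\<bar> \<le> bd f" using that bd[of f] by (intro mean_abs_le[of M f]) simp_all
    then show ?thesis by auto
  next
    case False
    then show ?thesis using that by (simp add: bd_def)
  qed
  then have "?P \<inter> ?K = ?K" by (intro Int_absorb1) (rule subsetI, rule PiE_I, simp_all)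
  ultimately show ?thesis
    using compact_Int_closed[of ?P ?K] by (simp only:)
qed

lemma is_mean_average:
  fixes M :: "('a::ab_group_add \<Rightarrow> real) \<Rightarrow> real"
  assumes "is_mean M" "N > 0"
  shows "is_mean (\<lambda>f. M (\<lambda>z. (\<Sum>k<N. f (z + h k)) / real N))"
proof -
  have b: "bounded (range (\<lambda>z. (\<Sum>k<N. f (z + h k)) / real N))" if "bounded (range f)" for f :: "'a \<Rightarrow> real"
    using bounded_range_cmult[OF bounded_range_sum, of "{..<N}" "\<lambda>k z. f (z + h k)" "1 / real N"] that
    by (simp add: bounded_range_shift)
  show ?thesis
    unfolding is_mean_def
  proof (intro conjI allI impI)
    fix f g :: "'a \<Rightarrow> real" assume fg: "bounded (range f)" "bounded (range g)"
    show "M (\<lambda>z. (\<Sum>k<N. f (z + h k) + g (z + h k)) / real N) =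
          M (\<lambda>z. (\<Sum>k<N. f (z + h k)) / real N) + M (\<lambda>z. (\<Sum>k<N. g (z + h k)) / real N)"
      using mean_add[OF assms(1) b[OF fg(1)] b[OF fg(2)]] by (simp add: sum.distrib add_divide_distrib)
  next
    fix c and f :: "'a \<Rightarrow> real" assume f: "bounded (range f)"
    show "M (\<lambda>z. (\<Sum>k<N. c * f (z + h k)) / real N) = c * M (\<lambda>z. (\<Sum>k<N. f (z + h k)) / real N)"
      using mean_cmult[OF assms(1) b[OF f], of c] by (simp add: sum_distrib_left)
  next
    fix f :: "'a \<Rightarrow> real" assume "bounded (range f)" "\<forall>z. 0 \<le> f z"
    then show "0 \<le> M (\<lambda>z. (\<Sum>k<N. f (z + h k)) / real N)"
      using assms by (intro mean_nonneg[OF assms(1) b]) (auto intro!: sum_nonneg divide_nonneg_nonneg)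
  next
    show "M (\<lambda>z. (\<Sum>k<N. 1) / real N) = 1" using assms by (simp add: mean_one)
  qed
qed

text \<open>An arbitrary bound \<open>B\<close> plays the role of the supremum norm of
  \<open>f\<close>. For fixed \<open>x\<close> and \<open>e\<close> this is a closed condition on
  \<open>M\<close> in the product topology, ready for a compactness argument.\<close>

definition almost_invariant :: "(('a::plus \<Rightarrow> real) \<Rightarrow> real) \<Rightarrow> 'a \<Rightarrow> real \<Rightarrow> bool" where
  "almost_invariant M x e \<longleftrightarrow>
     (\<forall>f B. (\<forall>z. \<bar>f z\<bar> \<le> B) \<longrightarrow> \<bar>M (\<lambda>z. f (z + x)) - M f\<bar> \<le> B * e)"

lemma almost_invariantI:
  assumes "\<And>f B. (\<And>z. \<bar>f z\<bar> \<le> B) \<Longrightarrow> \<bar>M (\<lambda>z. f (z + x)) - M f\<bar> \<le> B * e"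
  shows "almost_invariant M x e"
  using assms unfolding almost_invariant_def by simp

lemma almost_invariantD:
  assumes "almost_invariant M x e" "\<And>z. \<bar>f z\<bar> \<le> B"
  shows "\<bar>M (\<lambda>z. f (z + x)) - M f\<bar> \<le> B * e"
  using assms(1)[unfolded almost_invariant_def, THEN spec, THEN spec, THEN mp, OF allI, OF assms(2)] .

lemma closed_almost_invariant: "closed {M. almost_invariant M x e}"
  unfolding almost_invariant_def
  by (intro closed_Collect_all closed_Collect_imp closed_Collect_le open_Collect_const
      continuous_on_product_coordinates continuous_intros)

text \<open>The additive group is abelian, hence amenable: the averaging operators over the multiples
  \<open>0, x, \<dots>, (N - 1)x\<close> commute, so finitely many approximate invariance conditions can be satisfied
  simultaneously (Markov-Kakutani).\<close>

theorem invariant_mean_exists: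
  obtains M :: "('a::real_vector \<Rightarrow> real) \<Rightarrow> real"
  where "is_mean M" "\<And>f x. bounded (range f) \<Longrightarrow> M (\<lambda>z. f (z + x)) = M f"
proof -
  let ?K = "{M :: ('a \<Rightarrow> real) \<Rightarrow> real. is_mean M \<and> (\<forall>f. \<not> bounded (range f) \<longrightarrow> M f = 0)}"
  \<comment> \<open>Membership in \<open>C (x, n)\<close> for all \<open>n\<close> forces exact
    invariance under \<open>x\<close>, since the defect tends to 0.\<close>
  define C where "C i = {M. almost_invariant M (fst i) (2 / real (Suc (snd i)))}" for i :: "'a \<times> nat"
  have fin: "\<exists>M. is_mean M \<and> (\<forall>i\<in>I. M \<in> C i)" if "finite I" for I
    using that
  proof (induction I)
    case empty
    have "is_mean (\<lambda>f :: 'a \<Rightarrow> real. f 0)" by (simp add: is_mean_def)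
    then show ?case by blast
  next
    case (insert i I)
    then obtain M where M: "is_mean M" "\<forall>i\<in>I. M \<in> C i" by blast
    obtain x n where i: "i = (x, n)" by force
    define A where "A f = (\<lambda>z. (\<Sum>k<Suc n. f (z + real k *\<^sub>R x)) / real (Suc n))" for f :: "'a \<Rightarrow> real"
    have Ab: "\<bar>A f z\<bar> \<le> B" if "\<And>z. \<bar>f z\<bar> \<le> B" for f B z
    proof -
      have "\<bar>\<Sum>k<Suc n. f (z + real k *\<^sub>R x)\<bar> \<le> (\<Sum>k<Suc n. B)"
        by (rule order_trans[OF sum_abs sum_mono]) (rule that)
      then show ?thesis by (simp add: A_def field_simps)
    qed
    have mean: "is_mean (\<lambda>f. M (A f))"
      using is_mean_average[OF M(1), of "Suc n" "\<lambda>k. real k *\<^sub>R x"] by (simp add: A_def)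
    \<comment> \<open>\<open>A\<close> commutes with translations and does not increase bounds, so
      the conditions met so far survive averaging.\<close>
    have old: "(\<lambda>f. M (A f)) \<in> C j" if "j \<in> I" for j
    proof -
      have inv: "almost_invariant M (fst j) (2 / real (Suc (snd j)))"
        using M(2) that by (simp add: C_def)
      have "A (\<lambda>z. f (z + y)) = (\<lambda>z. A f (z + y))" for f y
        by (simp add: A_def add_ac)
      then have "almost_invariant (\<lambda>f. M (A f)) (fst j) (2 / real (Suc (snd j)))"
        by (intro almost_invariantI) (simp only: almost_invariantD[OF inv] Ab)
      then show ?thesis by (simp add: C_def)
    qed
    have "almost_invariant (\<lambda>f. M (A f)) x (2 / real (Suc n))"
    proof (rule almost_invariantI)
      fix f :: "'a \<Rightarrow> real" and B assume f: "\<And>z. \<bar>f z\<bar> \<le> B"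
      \<comment> \<open>Translating the average by \<open>x\<close> telescopes: only one new and one
        old term remain, each bounded by \<open>B\<close>, whence the 2 in the defect.\<close>
      let ?g = "\<lambda>z. (f (z + real (Suc n) *\<^sub>R x) - f z) / real (Suc n)"
      have eq: "A (\<lambda>z. f (z + x)) z - A f z = ?g z" for z
      proof -
        have "(\<Sum>k<Suc n. f (z + real k *\<^sub>R x + x)) = (\<Sum>k<Suc n. f (z + real (Suc k) *\<^sub>R x))"
          by (simp add: algebra_simps)
        moreover have "(\<Sum>k<Suc n. f (z + real (Suc k) *\<^sub>R x)) - (\<Sum>k<Suc n. f (z + real k *\<^sub>R x)) =
            f (z + real (Suc n) *\<^sub>R x) - f z"
          using sum_lessThan_telescope[of "\<lambda>k. f (z + real k *\<^sub>R x)" "Suc n"]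
          by (simp add: sum_subtractf)
        ultimately show ?thesis by (simp add: A_def diff_divide_distrib[symmetric])
      qed
      have "bounded (range (A (\<lambda>z. f (z + x))))" "bounded (range (A f))"
        using Ab[of "\<lambda>z. f (z + x)" B] Ab[of f B] f unfolding bounded_real_range_iff by blast+
      then have "M (A (\<lambda>z. f (z + x))) - M (A f) = M ?g"
        using mean_diff[OF M(1), of "A (\<lambda>z. f (z + x))" "A f"] by (simp only: eq)
      moreover have "\<bar>?g z\<bar> \<le> B * (2 / real (Suc n))" for z
      proof -
        have "\<bar>f (z + real (Suc n) *\<^sub>R x) - f z\<bar> \<le> B * 2"
          using f[of "z + real (Suc n) *\<^sub>R x"] f[of z] by linarith
        then show ?thesis by (simp add: divide_right_mono del: of_nat_Suc)
      qed
      then have "\<bar>M ?g\<bar> \<le> B * (2 / real (Suc n))" by (rule mean_abs_le[OF M(1)])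
      ultimately show "\<bar>M (A (\<lambda>z. f (z + x))) - M (A f)\<bar> \<le> B * (2 / real (Suc n))" by simp
    qed
    then have "(\<lambda>f. M (A f)) \<in> C i" by (simp add: C_def i)
    with mean old show ?case by (intro exI[of _ "\<lambda>f. M (A f)"]) simp
  qed
  have "?K \<inter> (\<Inter>i\<in>I. C i) \<noteq> {}" if "finite I" for I
  proof -
    obtain M where M: "is_mean M" "\<forall>i\<in>I. M \<in> C i" using fin \<open>finite I\<close> by blast
    \<comment> \<open>Values on unbounded functions are reset to 0 to land in the compact set;
      invariance is tested on bounded functions only and survives.\<close>
    define M' where "M' f = (if bounded (range f) then M f else 0)" for f
    have "is_mean M'"
      unfolding is_mean_def M'_def
      using is_meanD[OF M(1)] by (simp add: bounded_range_add bounded_range_cmult)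
    moreover have "M' \<in> C i" if "i \<in> I" for i
    proof -
      have inv: "almost_invariant M (fst i) (2 / real (Suc (snd i)))"
        using M(2) that by (simp add: C_def)
      have "almost_invariant M' (fst i) (2 / real (Suc (snd i)))"
      proof (rule almost_invariantI)
        fix f :: "'a \<Rightarrow> real" and B assume f: "\<And>z. \<bar>f z\<bar> \<le> B"
        then have "bounded (range f)" using bounded_real_range_iff by blast
        then have "M' f = M f" "M' (\<lambda>z. f (z + fst i)) = M (\<lambda>z. f (z + fst i))"
          by (simp_all add: M'_def bounded_range_shift)
        then show "\<bar>M' (\<lambda>z. f (z + fst i)) - M' f\<bar> \<le> B * (2 / real (Suc (snd i)))"
          using almost_invariantD[OF inv f] by simp
      qed
      then show ?thesis by (simp add: C_def)
    qed
    moreover have "\<forall>f. \<not> bounded (range f) \<longrightarrow> M' f = 0" by (simp add: M'_def)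
    ultimately have "M' \<in> ?K \<inter> (\<Inter>i\<in>I. C i)" by simp
    then show ?thesis by (metis empty_iff)
  qed
  moreover have "closed (C i)" for i
    unfolding C_def by (rule closed_almost_invariant)
  ultimately have "?K \<inter> (\<Inter>i\<in>UNIV. C i) \<noteq> {}"
    using compact_imp_fip_image[OF compact_means, of UNIV C] by simp
  then obtain M where "M \<in> ?K \<inter> (\<Inter>i\<in>UNIV. C i)" unfolding ex_in_conv[symmetric] by (rule exE)
  then have mean: "is_mean M" and C: "\<forall>i. M \<in> C i" by simp_all
  have "M (\<lambda>z. f (z + x)) = M f" if bf: "bounded (range f)" for f x
  proof -
    obtain B where B: "\<And>z. \<bar>f z\<bar> \<le> B"
      using bf unfolding bounded_real_range_iff by blast
    have "\<bar>M (\<lambda>z. f (z + x)) - M f\<bar> \<le> B * (2 / real (Suc n))" for n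
    proof (rule almost_invariantD[OF _ B])
      have "M \<in> C (x, n)" using C by simp
      then show "almost_invariant M x (2 / real (Suc n))" by (simp add: C_def)
    qed
    moreover have "(\<lambda>n. B * (2 / real (Suc n))) \<longlonglongrightarrow> B * 0"
      by (intro tendsto_mult_left LIMSEQ_Suc lim_const_over_n)
    ultimately have "\<bar>M (\<lambda>z. f (z + x)) - M f\<bar> \<le> B * 0"
      by (rule LIMSEQ_le_const[rotated, OF exI, OF allI, OF impI])
    then show ?thesis by simp
  qed
  with mean show thesis by (rule that)
qed

section \<open>Positive semidefinite kernels and functions of negative type\<close>

text \<open>Indices are natural numbers because kernels will be sampled along a sequence, later a
  dense one. Initial segments cover every finite set of indices, since coefficients may
  vanish.\<close>

definition psd_kernel :: "(nat \<Rightarrow> nat \<Rightarrow> real) \<Rightarrow> bool" where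
  "psd_kernel k \<longleftrightarrow> (\<forall>i j. k i j = k j i) \<and> (\<forall>N c. 0 \<le> (\<Sum>i<N. \<Sum>j<N. c i * c j * k i j))"

lemma psd_kernel_symD: "psd_kernel k \<Longrightarrow> k i j = k j i"
  unfolding psd_kernel_def by blast

lemma psd_kernel_nonneg: "psd_kernel k \<Longrightarrow> 0 \<le> (\<Sum>i<N. \<Sum>j<N. c i * c j * k i j)"
  unfolding psd_kernel_def by blast

text \<open>Evaluate the form at \<open>c\<close> plus \<open>t\<close> times the
  \<open>n\<close>-th unit vector. The quadratic polynomial in \<open>t\<close> yields both
  Cauchy-Schwarz and the case of a vanishing diagonal entry.\<close>

lemma psd_kernel_quadratic:
  assumes k: "psd_kernel k" and n: "n < N"
  shows "0 \<le> (\<Sum>i<N. \<Sum>j<N. c i * c j * k i j) + 2 * t * (\<Sum>i<N. c i * k i n) + t\<^sup>2 * k n n"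
proof -
  define d where "d i = (if i = n then t else 0)" for i
  have d: "(\<Sum>i<N. d i * g i) = t * g n" for g
    using n by (simp add: d_def if_distrib[of "\<lambda>x. x * _"] cong: if_cong)
  have "(\<Sum>i<N. \<Sum>j<N. (c i + d i) * (c j + d j) * k i j) =
      (\<Sum>i<N. \<Sum>j<N. c i * c j * k i j) + (\<Sum>i<N. c i * (\<Sum>j<N. d j * k i j)) +
      (\<Sum>i<N. d i * (\<Sum>j<N. c j * k i j)) + (\<Sum>i<N. d i * (\<Sum>j<N. d j * k i j))"
    by (simp add: algebra_simps sum.distrib sum_distrib_left)
  also have "\<dots> = (\<Sum>i<N. \<Sum>j<N. c i * c j * k i j) + (\<Sum>i<N. c i * (t * k i n)) +
      t * (\<Sum>j<N. c j * k n j) + t * (t * k n n)"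
    by (simp only: d)
  also have "(\<Sum>j<N. c j * k n j) = (\<Sum>j<N. c j * k j n)"
    using psd_kernel_symD[OF k] by (metis (no_types, lifting))
  also have "(\<Sum>i<N. c i * (t * k i n)) = t * (\<Sum>j<N. c j * k j n)"
    by (simp add: sum_distrib_left algebra_simps)
  finally show ?thesis
    using psd_kernel_nonneg[OF k, of "\<lambda>i. c i + d i" N] by (simp add: power2_eq_square algebra_simps)
qed

lemma psd_kernel_Cauchy_Schwarz:
  assumes k: "psd_kernel k" and n: "n < N"
  shows "(\<Sum>i<N. c i * k i n)\<^sup>2 / k n n \<le> (\<Sum>i<N. \<Sum>j<N. c i * c j * k i j)"
proof (cases "k n n = 0")
  case True
  then show ?thesis using psd_kernel_nonneg[OF k] by simp
next
  case False
  let ?B = "\<Sum>i<N. c i * k i n"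
  \<comment> \<open>\<open>- ?B / k n n\<close> is the value of \<open>t\<close> that minimises the
    polynomial of \<open>psd_kernel_quadratic\<close>.\<close>
  have "2 * (- ?B / k n n) * ?B + (- ?B / k n n)\<^sup>2 * k n n = - (?B\<^sup>2 / k n n)"
    using False by (simp add: power2_eq_square field_simps)
  then show ?thesis using psd_kernel_quadratic[OF assms, of c "- ?B / k n n"] by linarith
qed

text \<open>Without its quadratic term the polynomial in \<open>t\<close> is affine; it stays
  nonnegative only if its slope vanishes.\<close>

lemma psd_kernel_zero_row:
  assumes k: "psd_kernel k" and 0: "k n n = 0"
  shows "k j n = 0"
proof (rule ccontr)
  assume j: "k j n \<noteq> 0"
  define N where "N = Suc (max j n)"
  define c where "c i = (if i = j then 1 else 0 :: real)" for i
  have "(\<Sum>i<N. c i * k i n) = k j n"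
    by (simp add: c_def N_def if_distrib[of "\<lambda>x. x * _"] cong: if_cong)
  then have "0 \<le> (\<Sum>i<N. \<Sum>j<N. c i * c j * k i j) + 2 * t * k j n" for t
    using psd_kernel_quadratic[OF k, of n N c t] 0 by (simp add: N_def)
  moreover define Q where "Q = (\<Sum>i<N. \<Sum>j<N. c i * c j * k i j)"
  \<comment> \<open>This \<open>t\<close> would bring the affine function down to -1.\<close>
  ultimately have "0 \<le> Q + 2 * (- (Q + 1) / (2 * k j n)) * k j n" by blast
  with j show False by (simp add: field_simps)
qed

lemma psd_kernel_diag_nonneg:
  assumes "psd_kernel k" shows "0 \<le> k n n"
proof -
  have "0 \<le> (\<Sum>i<Suc n. \<Sum>j<Suc n. (if i = n then 1 else 0) * (if j = n then 1 else 0) * k i j)"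
    by (rule psd_kernel_nonneg[OF assms])
  then show ?thesis by (simp add: if_distrib[of "\<lambda>x. x * _"] cong: if_cong)
qed

text \<open>One step of the Cholesky decomposition. If \<open>k n n = 0\<close>, the convention \<open>x / 0 = 0\<close> makes the
  step trivial, as it should be.\<close>

definition schur_complement :: "nat \<Rightarrow> (nat \<Rightarrow> nat \<Rightarrow> real) \<Rightarrow> nat \<Rightarrow> nat \<Rightarrow> real" where
  "schur_complement n k i j = k i j - k i n * k j n / k n n"

text \<open>The quadratic form loses exactly the quotient that
  \<open>psd_kernel_Cauchy_Schwarz\<close> bounds by the form itself.\<close>

lemma psd_kernel_schur_complement:
  assumes k: "psd_kernel k"
  shows "psd_kernel (schur_complement n k)"
  unfolding psd_kernel_def schur_complement_def
proof (intro conjI allI)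
  show "k i j - k i n * k j n / k n n = k j i - k j n * k i n / k n n" for i j
    using psd_kernel_symD[OF k, of i j] by simp
next
  fix N and c :: "nat \<Rightarrow> real"
  \<comment> \<open>Cauchy-Schwarz asks for \<open>n\<close> to be among the indices, so the range
    is enlarged and \<open>c\<close> is padded with zeros.\<close>
  define N' where "N' = max N (Suc n)"
  define c' where "c' i = (if i < N then c i else 0)" for i
  have ext: "(\<Sum>i<N. c i * g i) = (\<Sum>i<N'. c' i * g i)" for g
    by (rule sum.mono_neutral_cong_left) (auto simp: c'_def N'_def)
  have eq: "(\<Sum>i<N. \<Sum>j<N. c i * c j * h i j) = (\<Sum>i<N'. \<Sum>j<N'. c' i * c' j * h i j)" for h
  proof -
    have "(\<Sum>i<N. \<Sum>j<N. c i * c j * h i j) = (\<Sum>i<N. c i * (\<Sum>j<N. c j * h i j))"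
      by (simp add: sum_distrib_left mult.assoc)
    also have "\<dots> = (\<Sum>i<N'. c' i * (\<Sum>j<N'. c' j * h i j))" by (simp only: ext)
    finally show ?thesis by (simp add: sum_distrib_left mult.assoc)
  qed
  have "(\<Sum>i<N'. \<Sum>j<N'. c' i * c' j * (k i j - k i n * k j n / k n n)) =
      (\<Sum>i<N'. \<Sum>j<N'. c' i * c' j * k i j) - (\<Sum>i<N'. \<Sum>j<N'. (c' i * k i n) * (c' j * k j n)) / k n n"
    by (simp add: algebra_simps sum_subtractf sum_divide_distrib)
  also have "(\<Sum>i<N'. \<Sum>j<N'. (c' i * k i n) * (c' j * k j n)) = (\<Sum>i<N'. c' i * k i n)\<^sup>2"
    by (simp add: power2_eq_square sum_product)
  finally show "0 \<le> (\<Sum>i<N. \<Sum>j<N. c i * c j * (k i j - k i n * k j n / k n n))"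
    using psd_kernel_Cauchy_Schwarz[OF k, of n N' c'] by (simp add: eq N'_def)
qed

primrec schur_iterate :: "(nat \<Rightarrow> nat \<Rightarrow> real) \<Rightarrow> nat \<Rightarrow> nat \<Rightarrow> nat \<Rightarrow> real" where
  "schur_iterate k 0 = k"
| "schur_iterate k (Suc n) = schur_complement n (schur_iterate k n)"

lemma psd_schur_iterate: "psd_kernel k \<Longrightarrow> psd_kernel (schur_iterate k n)"
  by (induction n) (auto intro: psd_kernel_schur_complement)

text \<open>Eliminating an index kills its row; if the pivot is zero, the row is zero already. A
  zero row stays zero, because its correction contains one of its own entries as a factor.\<close>

lemma schur_iterate_eq_0:
  assumes k: "psd_kernel k" and "i < n"
  shows "schur_iterate k n i j = 0"
  using \<open>i < n\<close>
proof (induction n arbitrary: i j)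
  case (Suc n)
  let ?K = "schur_iterate k n"
  note K = psd_schur_iterate[OF k, of n]
  show ?case
  proof (cases "i = n")
    case True
    then show ?thesis
      using psd_kernel_zero_row[OF K, of n j] psd_kernel_symD[OF K, of n j]
      by (cases "?K n n = 0") (auto simp: schur_complement_def)
  next
    case False
    then show ?thesis using Suc by (simp add: schur_complement_def)
  qed
qed simp

text \<open>Cholesky decomposition: the rows of the lower triangular factor \<open>c\<close> are
  finite, so each \<open>v i\<close> is a finite combination of the orthonormal vectors
  \<open>e n\<close>.\<close>

lemma gram_realization:
  fixes e :: "nat \<Rightarrow> 'h::real_inner"
  assumes k: "psd_kernel k" and e: "\<And>m n. inner (e m) (e n) = (if m = n then 1 else 0)"
  obtains v :: "nat \<Rightarrow> 'h" where "\<And>i j. inner (v i) (v j) = k i j"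
proof -
  let ?K = "schur_iterate k"
  define c where "c i n = ?K n i n / sqrt (?K n n n)" for i n
  have c_mult: "c i n * c j n = ?K n i n * ?K n j n / ?K n n n" for i j n
    using psd_kernel_diag_nonneg[OF psd_schur_iterate[OF k], of n n] by (simp add: c_def)
  have c_0: "c i n = 0" if "i < n" for i n
    using schur_iterate_eq_0[OF k that] by (simp add: c_def)
  \<comment> \<open>Each elimination step subtracts one rank-one term, so the kernel is the sum of
    these terms plus a remainder, which vanishes in row \<open>i\<close> as soon as
    \<open>i < m\<close>.\<close>
  have expand: "k i j = (\<Sum>n<m. c i n * c j n) + ?K m i j" for i j m
    by (induction m) (simp_all add: c_mult schur_complement_def)
  have k_eq: "k i j = (\<Sum>n<m. c i n * c j n)" if "i < m" for i j m
    using expand[of i j m] schur_iterate_eq_0[OF k that, of j] by simp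
  define v where "v i = (\<Sum>n<Suc i. c i n *\<^sub>R e n)" for i
  have v: "v i = (\<Sum>n<m. c i n *\<^sub>R e n)" if "i < m" for i m
    unfolding v_def by (rule sum.mono_neutral_left) (use that in \<open>auto simp: c_0\<close>)
  have "inner (v i) (v j) = k i j" for i j
  proof -
    obtain m where m: "i < m" "j < m" by (meson lessI less_max_iff_disj)
    have "inner (v i) (v j) = (\<Sum>n'<m. c j n' * (\<Sum>n<m. c i n * (if n = n' then 1 else 0)))"
      unfolding v[OF m(1)] v[OF m(2)] by (simp add: inner_sum_left inner_sum_right e)
    also have "\<dots> = (\<Sum>n<m. c i n * c j n)"
      by (rule sum.cong) (simp_all add: if_distrib[of "\<lambda>x. _ * x"] cong: if_cong)
    also have "\<dots> = k i j" using k_eq[OF m(1)] by simp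
    finally show ?thesis .
  qed
  then show thesis by (rule that)
qed

section \<open>The standard orthonormal system of \<open>'i ell2\<close>\<close>

lift_definition unit_ell2 :: "'i \<Rightarrow> 'i ell2" is "\<lambda>i j. if j = i then 1 else 0"
proof -
  fix i :: 'i
  have "(\<lambda>j. (if j = i then 1 else 0 :: real)\<^sup>2) summable_on {i}" by simp
  then show "(\<lambda>j. (if j = i then 1 else 0 :: real)\<^sup>2) summable_on UNIV"
    by (rule summable_on_cong_neutral[THEN iffD1, rotated -1]) auto
qed

lemma inner_unit_ell2: "inner (unit_ell2 i) (unit_ell2 j) = (if i = j then 1 else 0)"
proof transfer
  fix i j :: 'i
  have "(\<Sum>\<^sub>\<infinity>l. (if l = i then 1 else 0) * (if l = j then 1 else 0 :: real)) =
      (\<Sum>\<^sub>\<infinity>l\<in>{i}. (if l = i then 1 else 0) * (if l = j then 1 else 0))"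
    by (rule infsum_cong_neutral) auto
  then show "(\<Sum>\<^sub>\<infinity>l. (if l = i then 1 else 0) * (if l = j then 1 else 0 :: real)) = (if i = j then 1 else 0)"
    by simp
qed

lemma gram_realization_ell2:
  assumes "psd_kernel k" "infinite (UNIV :: 'i set)"
  obtains v :: "nat \<Rightarrow> 'i ell2" where "\<And>i j. inner (v i) (v j) = k i j"
proof -
  obtain \<iota> :: "nat \<Rightarrow> 'i" where "inj \<iota>"
    using assms(2) infinite_countable_subset by blast
  then have "inner (unit_ell2 (\<iota> m)) (unit_ell2 (\<iota> n)) = (if m = n then 1 else 0)" for m n
    by (simp add: inner_unit_ell2 inj_eq)
  from gram_realization[OF assms(1) this] that show thesis by blast
qed

text \<open>Conditionally negative definite functions vanishing at 0. The kernel in the sum is twice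
  the Gram kernel of a map \<open>b\<close> with \<open>b 0 = 0\<close> and squared distances
  \<open>\<psi> (x - y)\<close>; its positivity replaces the usual condition on coefficients of sum
  zero.\<close>

definition negative_type :: "('a::ab_group_add \<Rightarrow> real) \<Rightarrow> bool" where
  "negative_type \<psi> \<longleftrightarrow> \<psi> 0 = 0 \<and> (\<forall>x. \<psi> (- x) = \<psi> x) \<and>
     (\<forall>N c x. 0 \<le> (\<Sum>i<N::nat. \<Sum>j<N. c i * c j * (\<psi> (x i) + \<psi> (x j) - \<psi> (x i - x j))))"

lemma negative_typeD:
  assumes "negative_type \<psi>"
  shows negative_type_0: "\<psi> 0 = 0" and negative_type_minus: "\<psi> (- x) = \<psi> x"
    and negative_type_sum: "\<And>x. 0 \<le> (\<Sum>i<N::nat. \<Sum>j<N. c i * c j * (\<psi> (x i) + \<psi> (x j) - \<psi> (x i - x j)))"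
  using assms unfolding negative_type_def by blast+

lemma negative_type_commute:
  "negative_type \<psi> \<Longrightarrow> \<psi> (x - y) = \<psi> (y - x)"
  using negative_type_minus[of \<psi> "x - y"] by simp

lemma psd_negative_type:
  assumes "negative_type \<psi>"
  shows "psd_kernel (\<lambda>i j. (\<psi> (x i) + \<psi> (x j) - \<psi> (x i - x j)) / 2)"
  unfolding psd_kernel_def
  using negative_type_sum[OF assms, where x = x] negative_type_commute[OF assms]
  by (auto simp: sum_divide_distrib[symmetric])

lemma negative_type_realization:
  assumes \<psi>: "negative_type \<psi>" and "infinite (UNIV :: 'i set)"
  obtains v :: "nat \<Rightarrow> 'i ell2" where
    "\<And>i j. inner (v i) (v j) = (\<psi> (x i) + \<psi> (x j) - \<psi> (x i - x j)) / 2"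
  using gram_realization_ell2[OF psd_negative_type[OF \<psi>, of x] assms(2)] by metis

lemma dist_sq_gram:
  fixes u v :: "'h::real_inner"
  assumes "inner u u = a" "inner v v = b" "inner u v = (a + b - c) / 2"
  shows "(dist u v)\<^sup>2 = c"
  using assms by (simp add: dist_norm power2_norm_eq_inner inner_diff_left inner_diff_right inner_commute)

lemma negative_type_nonneg: "negative_type \<psi> \<Longrightarrow> 0 \<le> \<psi> x"
  using psd_kernel_diag_nonneg[OF psd_negative_type[of \<psi> "\<lambda>_. x"]] by (simp add: negative_type_0)

text \<open>In a Hilbert space realisation, the points belonging to \<open>x\<close> and
  \<open>y\<close> have distance \<open>sqrt (\<psi> (x - y))\<close> from each other, and
  \<open>sqrt (\<psi> x)\<close> and \<open>sqrt (\<psi> y)\<close> from the origin.\<close>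

lemma negative_type_triangle:
  assumes \<psi>: "negative_type \<psi>"
  shows "sqrt (\<psi> x) \<le> sqrt (\<psi> y) + sqrt (\<psi> (x - y))"
proof -
  define p where "p i = (if i = 0 then x else y)" for i :: nat
  obtain v :: "nat \<Rightarrow> nat ell2" where
    v: "\<And>i j. inner (v i) (v j) = (\<psi> (p i) + \<psi> (p j) - \<psi> (p i - p j)) / 2"
    using negative_type_realization[OF \<psi>] infinite_UNIV_nat by metis
  have diag: "inner (v i) (v i) = \<psi> (p i)" for i
    by (simp add: v negative_type_0[OF \<psi>])
  have "(dist (v 0) (v 1))\<^sup>2 = \<psi> (x - y)"
    using dist_sq_gram[OF diag diag v] by (simp add: p_def)
  then have "norm (v 0 - v 1) = sqrt (\<psi> (x - y))"
    by (metis dist_norm real_sqrt_abs abs_norm_cancel)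
  moreover have "norm (v 0) = sqrt (\<psi> x)" "norm (v 1) = sqrt (\<psi> y)"
    using diag by (simp_all add: norm_eq_sqrt_inner p_def)
  ultimately show ?thesis using norm_triangle_sub[of "v 0" "v 1"] by simp
qed

lemma negative_type_double:
  assumes \<psi>: "negative_type \<psi>"
  shows "\<psi> (x + x) \<le> 4 * \<psi> x"
proof -
  have "sqrt (\<psi> (x + x)) \<le> 2 * sqrt (\<psi> x)"
    using negative_type_triangle[OF \<psi>, of "x + x" x] by simp
  then show ?thesis
    using power_mono[of "sqrt (\<psi> (x + x))" "2 * sqrt (\<psi> x)" 2] negative_type_nonneg[OF \<psi>]
    by (simp add: power_mult_distrib)
qed

text \<open>The square root of \<open>\<psi>\<close> is subadditive and even, so its oscillation
  near any point is bounded by its values near 0.\<close>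

lemma negative_type_continuous:
  fixes \<psi> :: "'a::real_normed_vector \<Rightarrow> real"
  assumes \<psi>: "negative_type \<psi>" and cont: "(\<psi> \<longlongrightarrow> 0) (at 0)"
  shows "continuous_on UNIV \<psi>"
proof -
  have "isCont (\<lambda>x. sqrt (\<psi> x)) x" for x
  proof -
    have "((\<lambda>h. sqrt (\<psi> h)) \<longlongrightarrow> 0) (at 0)"
      using tendsto_real_sqrt[OF cont] by simp
    then have "((\<lambda>h. sqrt (\<psi> (x + h)) - sqrt (\<psi> x)) \<longlongrightarrow> 0) (at 0)"
    proof (rule Lim_null_comparison[rotated], intro always_eventually allI)
      fix h
      show "norm (sqrt (\<psi> (x + h)) - sqrt (\<psi> x)) \<le> sqrt (\<psi> h)"
        using negative_type_triangle[OF \<psi>, of "x + h" x] negative_type_triangle[OF \<psi>, of x "x + h"]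
          negative_type_minus[OF \<psi>, of h] by simp
    qed
    then show ?thesis
      unfolding isCont_iff by (rule LIM_zero_cancel)
  qed
  then have "continuous_on UNIV (\<lambda>x. (sqrt (\<psi> x))\<^sup>2)"
    by (intro continuous_on_power) (simp add: continuous_on_eq_continuous_at)
  then show ?thesis using negative_type_nonneg[OF \<psi>] by simp
qed

text \<open>The kernel is realised on a countable dense set. There the map is uniformly continuous,
  as distances depend only on \<open>\<psi> (x - y)\<close>, and it extends by completeness. The
  Gram identity follows by density in one variable at a time.\<close>

lemma separable_negative_type_embedding:
  fixes \<psi> :: "'a::real_normed_vector \<Rightarrow> real"
  assumes sep: "separable_space (euclidean :: 'a topology)" and inf: "infinite (UNIV :: 'i set)"
    and \<psi>: "negative_type \<psi>" and cont: "(\<psi> \<longlongrightarrow> 0) (at 0)"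
  obtains b :: "'a \<Rightarrow> 'i ell2" where
    "continuous_on UNIV b" "\<And>x y. inner (b x) (b y) = (\<psi> x + \<psi> y - \<psi> (x - y)) / 2"
proof -
  let ?k = "\<lambda>x y. (\<psi> x + \<psi> y - \<psi> (x - y)) / 2"
  obtain C :: "'a set" where C: "countable C" "closure C = UNIV"
    using sep unfolding separable_space_def by auto
  then have "C \<noteq> {}" by auto
  obtain v :: "nat \<Rightarrow> 'i ell2" where
    v: "\<And>i j. inner (v i) (v j) = ?k (from_nat_into C i) (from_nat_into C j)"
    using negative_type_realization[OF \<psi> inf] by metis
  define f where "f x = v (to_nat_on C x)" for x
  have f: "inner (f x) (f y) = ?k x y" if "x \<in> C" "y \<in> C" for x y
    using that C(1) by (simp add: f_def v)
  have \<psi>_cont: "continuous_on S \<psi>" for S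
    using negative_type_continuous[OF \<psi> cont] continuous_on_subset by blast
  have "uniformly_continuous_on C f"
    unfolding uniformly_continuous_on_def
  proof (intro allI impI)
    fix e :: real assume e: "0 < e"
    then obtain d where d: "d > 0" "\<forall>h. h \<noteq> 0 \<and> norm h < d \<longrightarrow> \<bar>\<psi> h\<bar> < e\<^sup>2"
      using LIM_D[OF cont, of "e\<^sup>2"] by auto
    have "dist (f y) (f x) < e" if "x \<in> C" "y \<in> C" "dist y x < d" for x y
    proof -
      have "(dist (f y) (f x))\<^sup>2 = \<psi> (y - x)"
        using that by (intro dist_sq_gram[OF _ _ f]) (auto simp: f negative_type_0[OF \<psi>])
      also have "\<dots> < e\<^sup>2"
        using d(2)[rule_format, of "y - x"] that e by (cases "y = x") (auto simp: negative_type_0[OF \<psi>] dist_norm)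
      finally show ?thesis using e by (simp add: power_less_imp_less_base)
    qed
    then show "\<exists>d>0. \<forall>x\<in>C. \<forall>x'\<in>C. dist x' x < d \<longrightarrow> dist (f x') (f x) < e"
      using d(1) by blast
  qed
  then obtain b where b: "uniformly_continuous_on (closure C) b" "\<And>x. x \<in> C \<Longrightarrow> f x = b x"
    using uniformly_continuous_on_extension_on_closure by metis
  then have b_cont: "continuous_on UNIV b"
    using C(2) uniformly_continuous_imp_continuous by metis
  have closed: "closed {x. inner (b x) (b y) = ?k x y}" for y
    by (intro closed_Collect_eq continuous_intros b_cont continuous_on_compose2[OF \<psi>_cont]) auto
  have "{x. inner (b x) (b y) = ?k x y} = UNIV" if "y \<in> C" for y
    using closure_minimal[OF _ closed[of y], of C] C(2) f b(2) that by auto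
  then have 1: "inner (b x) (b y) = ?k x y" if "y \<in> C" for x y
    using that by blast
  have "inner (b y) (b x) = ?k y x" if "y \<in> C" for x y
    using 1[OF that, of x] negative_type_commute[OF \<psi>, of x y] by (simp add: inner_commute)
  then have "{x. inner (b x) (b y) = ?k x y} = UNIV" for y
    using closure_minimal[OF _ closed[of y], of C] C(2) by auto
  then show thesis by (intro that[of b] b_cont) blast
qed

section \<open>Isometric representations from cocycles\<close>

lemma subspace_closure:
  fixes S :: "'a::real_normed_vector set"
  assumes S: "subspace S"
  shows "subspace (closure S)"
  unfolding subspace_def
proof (intro conjI ballI allI)
  show "0 \<in> closure S" using subspace_0[OF S] closure_subset by blast
next
  fix x y assume "x \<in> closure S" "y \<in> closure S"
  then obtain u v where "\<forall>n. u n \<in> S" "u \<longlonglongrightarrow> x" "\<forall>n. v n \<in> S" "v \<longlonglongrightarrow> y"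
    unfolding closure_sequential by blast
  then have "\<forall>n. u n + v n \<in> S" "(\<lambda>n. u n + v n) \<longlonglongrightarrow> x + y"
    using subspace_add[OF S] by (auto intro: tendsto_add)
  then show "x + y \<in> closure S"
    unfolding closure_sequential by (intro exI[of _ "\<lambda>n. u n + v n"]) simp
next
  fix c x assume "x \<in> closure S"
  then obtain u where "\<forall>n. u n \<in> S" "u \<longlonglongrightarrow> x"
    unfolding closure_sequential by blast
  then have "\<forall>n. c *\<^sub>R u n \<in> S" "(\<lambda>n. c *\<^sub>R u n) \<longlonglongrightarrow> c *\<^sub>R x"
    using subspace_scale[OF S] by (auto intro: tendsto_scaleR)
  then show "c *\<^sub>R x \<in> closure S"
    unfolding closure_sequential by (intro exI[of _ "\<lambda>n. c *\<^sub>R u n"]) simp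
qed

text \<open>By the parallelogram law a minimising sequence for the distance to \<open>S\<close> is
  Cauchy, and its limit cannot be improved in any direction of \<open>S\<close>.\<close>

lemma closed_subspace_projection:
  fixes S :: "'h::{real_inner, complete_space} set"
  assumes S: "subspace S" "closed S"
  obtains p where "p \<in> S" "\<And>s. s \<in> S \<Longrightarrow> inner (v - p) s = 0"
proof -
  define d where "d = infdist v S"
  have ne: "S \<noteq> {}" using subspace_0[OF S(1)] by blast
  have d_le: "d \<le> norm (v - s)" if "s \<in> S" for s
    using infdist_le[OF that, of v] by (simp add: d_def dist_norm)
  have d0: "0 \<le> d" by (simp add: d_def infdist_nonneg)
  have "\<exists>s\<in>S. norm (v - s) < d + 1 / real (Suc n)" for n
  proof -
    have "(INF s\<in>S. dist v s) < d + 1 / real (Suc n)"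
      using ne by (simp add: d_def infdist_notempty)
    then show ?thesis
      using ne by (subst (asm) cINF_less_iff) (auto simp: dist_norm intro: bdd_belowI[of _ 0])
  qed
  then obtain p where p: "\<And>n. p n \<in> S" "\<And>n. norm (v - p n) < d + 1 / real (Suc n)" by metis
  have lim: "(\<lambda>n. norm (v - p n)) \<longlonglongrightarrow> d"
  proof (rule tendsto_sandwich[OF _ _ tendsto_const])
    show "(\<lambda>n. d + 1 / real (Suc n)) \<longlonglongrightarrow> d"
      using tendsto_add[OF tendsto_const[of d] LIMSEQ_Suc[OF lim_const_over_n[of 1]]] by simp
    show "eventually (\<lambda>n. norm (v - p n) \<le> d + 1 / real (Suc n)) sequentially"
      using p(2) by (intro always_eventually allI less_imp_le)
    show "eventually (\<lambda>n. d \<le> norm (v - p n)) sequentially"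
      using d_le[OF p(1)] by simp
  qed
  have par: "(dist (p m) (p n))\<^sup>2 \<le> 2 * (norm (v - p m))\<^sup>2 + 2 * (norm (v - p n))\<^sup>2 - 4 * d\<^sup>2" for m n
  proof -
    have "(1 / 2) *\<^sub>R (p m + p n) \<in> S"
      by (intro subspace_scale[OF S(1)] subspace_add[OF S(1)] p)
    then have "d\<^sup>2 \<le> (norm (v - (1 / 2) *\<^sub>R (p m + p n)))\<^sup>2"
      using d_le d0 by (intro power_mono) auto
    moreover have "(dist (p m) (p n))\<^sup>2 + 4 * (norm (v - (1 / 2) *\<^sub>R (p m + p n)))\<^sup>2 =
        2 * (norm (v - p m))\<^sup>2 + 2 * (norm (v - p n))\<^sup>2"
      by (simp add: dist_norm power2_norm_eq_inner inner_simps inner_commute algebra_simps)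
    ultimately show ?thesis by simp
  qed
  have "Cauchy p"
  proof (rule metric_CauchyI)
    fix e :: real assume e: "0 < e"
    have "(\<lambda>n. (norm (v - p n))\<^sup>2) \<longlonglongrightarrow> d\<^sup>2" by (intro tendsto_intros lim)
    then have "eventually (\<lambda>n. (norm (v - p n))\<^sup>2 < d\<^sup>2 + e\<^sup>2 / 4) sequentially"
      using e by (intro order_tendstoD(2)) auto
    then obtain N where N: "\<And>n. n \<ge> N \<Longrightarrow> (norm (v - p n))\<^sup>2 < d\<^sup>2 + e\<^sup>2 / 4"
      unfolding eventually_sequentially by blast
    have "dist (p m) (p n) < e" if "m \<ge> N" "n \<ge> N" for m n
    proof -
      have "(dist (p m) (p n))\<^sup>2 < e\<^sup>2" using par[of m n] N[OF that(1)] N[OF that(2)] by linarith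
      then show ?thesis using e by (simp add: power_less_imp_less_base)
    qed
    then show "\<exists>N. \<forall>m\<ge>N. \<forall>n\<ge>N. dist (p m) (p n) < e" by blast
  qed
  then obtain q where q: "p \<longlonglongrightarrow> q" by (meson Cauchy_convergent convergentD)
  have qS: "q \<in> S" using closed_sequentially[OF S(2) p(1) q] .
  have "(\<lambda>n. norm (v - p n)) \<longlonglongrightarrow> norm (v - q)" by (intro tendsto_intros q)
  then have nq: "norm (v - q) = d" using lim LIMSEQ_unique by blast
  have "inner (v - q) s = 0" if s: "s \<in> S" for s
  proof (rule ccontr)
    let ?a = "inner (v - q) s"
    assume a: "?a \<noteq> 0"
    then have "s \<noteq> 0" by auto
    \<comment> \<open>\<open>t *\<^sub>R s\<close> is the point nearest to \<open>v - q\<close> on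
      the line through \<open>s\<close>; the squared distance would drop by
      \<open>?a\<^sup>2 / inner s s\<close>.\<close>
    define t where "t = ?a / inner s s"
    have "q + t *\<^sub>R s \<in> S" by (intro subspace_add[OF S(1)] subspace_scale[OF S(1)] qS s)
    then have "d\<^sup>2 \<le> (norm (v - q - t *\<^sub>R s))\<^sup>2"
      using d_le[of "q + t *\<^sub>R s"] d0 by (intro power_mono) (auto simp: algebra_simps)
    also have "\<dots> = d\<^sup>2 - 2 * t * ?a + t * (t * inner s s)"
      unfolding nq[symmetric] power2_norm_eq_inner
      by (simp add: inner_simps inner_commute algebra_simps)
    also have "t * inner s s = ?a" using \<open>s \<noteq> 0\<close> by (simp add: t_def)
    finally have "t * ?a \<le> 0" by (simp add: algebra_simps)
    moreover have "t * ?a = ?a\<^sup>2 / inner s s" by (simp add: t_def power2_eq_square)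
    moreover have "?a\<^sup>2 / inner s s > 0" using a \<open>s \<noteq> 0\<close> by simp
    ultimately show False by simp
  qed
  with qS show thesis by (rule that)
qed

text \<open>A vector splits into its projection onto the closed span of \<open>A\<close> and a rest
  orthogonal to \<open>A\<close>. Isometries prescribed on this enlarged family are determined on
  the whole space.\<close>

lemma closure_span_Un_orthogonal:
  fixes A :: "'h::{real_inner, complete_space} set"
  shows "closure (span (A \<union> {q. \<forall>a\<in>A. inner q a = 0})) = UNIV" (is "closure (span ?B) = UNIV")
proof -
  have "v \<in> closure (span ?B)" for v
  proof -
    obtain p where p: "p \<in> closure (span A)" "\<And>s. s \<in> closure (span A) \<Longrightarrow> inner (v - p) s = 0"
      using closed_subspace_projection[of "closure (span A)" v] by (auto simp: subspace_closure)
    have "a \<in> closure (span A)" if "a \<in> A" for a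
      using that closure_subset span_base by blast
    then have "v - p \<in> span ?B" using p(2) by (intro span_base) simp
    then have "v - p \<in> closure (span ?B)" using closure_subset by blast
    moreover have "p \<in> closure (span ?B)"
      using p(1) closure_mono[OF span_mono[of A ?B]] by blast
    ultimately have "p + (v - p) \<in> closure (span ?B)"
      by (intro subspace_add subspace_closure) simp_all
    then show ?thesis by simp
  qed
  then show ?thesis by blast
qed

text \<open>The closed linear span \<open>G\<close> of the pairs \<open>(f i, g i)\<close> is the
  graph of the isometry: equal Gram matrices force both components of every pair in \<open>G\<close>
  to have the same norm.\<close>

lemma isometry_extension:
  fixes f g :: "'i \<Rightarrow> 'h::{real_inner, complete_space}"
  assumes gram: "\<And>i j. inner (f i) (f j) = inner (g i) (g j)"
    and dense: "closure (span (range f)) = UNIV"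
  obtains T where "linear T" "\<And>v. norm (T v) = norm v" "\<And>i. T (f i) = g i"
proof -
  let ?R = "range (\<lambda>i. (f i, g i))"
  define G where "G = closure (span ?R)"
  have subG: "subspace G" by (simp add: G_def subspace_closure)
  have fgG: "(f i, g i) \<in> G" for i
    using closure_subset[of "span ?R"] span_base[of "(f i, g i)" ?R] by (auto simp: G_def)
  have 1: "inner (fst p) (f i) = inner (snd p) (g i)" if "p \<in> span ?R" for p i
    using that by (induction rule: span_induct_alt) (auto simp: gram inner_simps)
  have 2: "inner (fst p) (fst q) = inner (snd p) (snd q)" if p: "p \<in> span ?R" and "q \<in> span ?R" for p q
    using that(2) by (induction rule: span_induct_alt) (auto simp: 1[OF p] inner_simps)
  have "span ?R \<subseteq> {p. norm (snd p) = norm (fst p)}"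
    using 2 by (auto simp: norm_eq_sqrt_inner)
  moreover have "closed {p :: 'h \<times> 'h. norm (snd p) = norm (fst p)}"
    by (intro closed_Collect_eq continuous_intros)
  ultimately have "G \<subseteq> {p. norm (snd p) = norm (fst p)}"
    unfolding G_def by (rule closure_minimal)
  then have norm: "norm (snd p) = norm (fst p)" if "p \<in> G" for p
    using that by blast
  \<comment> \<open>Convergent first components make the second components Cauchy, so by
    completeness the pairs converge, and their limit lies in \<open>G\<close>.\<close>
  have "closed (fst ` G)"
    unfolding closed_sequential_limits
  proof (intro allI impI, elim conjE)
    fix x l assume x: "\<forall>n. x n \<in> fst ` G" "x \<longlonglongrightarrow> l"
    then have "\<exists>u. (x n, u) \<in> G" for n by (metis imageE prod.collapse)
    then obtain y where y: "\<And>n. (x n, y n) \<in> G" by metis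
    have "dist (y m) (y n) = dist (x m) (x n)" for m n
      using norm[OF subspace_diff[OF subG y[of m] y[of n]]] by (simp add: dist_norm)
    then have "Cauchy y" using LIMSEQ_imp_Cauchy[OF x(2)] unfolding Cauchy_def by simp
    then obtain l' where "y \<longlonglongrightarrow> l'" by (meson Cauchy_convergent convergentD)
    then have "(\<lambda>n. (x n, y n)) \<longlonglongrightarrow> (l, l')" by (intro tendsto_Pair x)
    then have "(l, l') \<in> G" using closed_sequentially[of G "\<lambda>n. (x n, y n)"] y by (simp add: G_def)
    then show "l \<in> fst ` G" by force
  qed
  moreover have "subspace (fst ` G)"
    by (intro linear_subspace_image subG linear_fst)
  then have "span (range f) \<subseteq> fst ` G"
    by (intro span_minimal) (use fgG in force)
  ultimately have "fst ` G = UNIV" using closure_minimal dense by blast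
  then have "\<exists>u. (v, u) \<in> G" for v by (metis UNIV_I imageE prod.collapse)
  then obtain T where T: "\<And>v. (v, T v) \<in> G" by metis
  \<comment> \<open>A pair in \<open>G\<close> whose first component is 0 also has second component
    0.\<close>
  have uniq: "T v = u" if "(v, u) \<in> G" for v u
    using norm[OF subspace_diff[OF subG T[of v] that]] by simp
  show thesis
  proof (rule that)
    show "linear T"
    proof (rule linearI)
      show "T (v + w) = T v + T w" for v w
        using subspace_add[OF subG T T, of v w] by (intro uniq) simp
      show "T (c *\<^sub>R v) = c *\<^sub>R T v" for c v
        using subspace_scale[OF subG T, of c v] by (intro uniq) simp
    qed
    show "norm (T v) = norm v" for v using norm[OF T] by simp
    show "T (f i) = g i" for i using fgG by (rule uniq)
  qed
qed

section \<open>Arguments from a dense span\<close>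

lemma dense_span_induct:
  assumes dense: "closure (span (range f)) = UNIV"
    and "subspace {v. P v}" "closed {v. P v}" "\<And>i. P (f i)"
  shows "P v"
proof -
  have "span (range f) \<subseteq> {v. P v}" using assms by (intro span_minimal) auto
  then have "closure (span (range f)) \<subseteq> {v. P v}" using assms by (intro closure_minimal)
  then show ?thesis using dense by auto
qed

lemma isometry_continuous:
  fixes T :: "'h::real_normed_vector \<Rightarrow> 'k::real_normed_vector"
  assumes "linear T" "\<And>v. norm (T v) = norm v"
  shows "continuous_on S T"
  using assms
  by (intro linear_continuous_on bounded_linear_intro[where K = 1]) (simp_all add: linear_add linear_scale)

lemma isometries_eqI:
  fixes T T' :: "'h::real_normed_vector \<Rightarrow> 'h"
  assumes dense: "closure (span (range f)) = UNIV"
    and T: "linear T" "\<And>v. norm (T v) = norm v" and T': "linear T'" "\<And>v. norm (T' v) = norm v"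
    and eq: "\<And>i. T (f i) = T' (f i)"
  shows "T = T'"
proof
  fix v show "T v = T' v"
    using dense
  proof (rule dense_span_induct[where P = "\<lambda>v. T v = T' v"])
    show "subspace {v. T v = T' v}"
      using T(1) T'(1) by (auto simp: subspace_def linear_0 linear_add linear_scale)
    show "closed {v. T v = T' v}"
      by (intro closed_Collect_eq isometry_continuous assms)
  qed (rule eq)
qed

text \<open>The representation is determined on the range of \<open>b\<close> by the cocycle identity; it is extended
  by the identity on the orthogonal complement.\<close>

lemma cocycle_representation:
  fixes b :: "'a::real_normed_vector \<Rightarrow> 'h::{real_inner, complete_space}"
  assumes gram: "\<And>x y. inner (b x) (b y) = (\<psi> x + \<psi> y - \<psi> (x - y)) / 2"
    and \<psi>: "\<And>x. \<psi> (- x) = \<psi> x" and 0: "b 0 = 0" and cont: "continuous_on UNIV b"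
  obtains \<pi> where "isometric_representation \<pi>" "strongly_continuous \<pi>"
    "\<And>x y. b (x + y) = \<pi> x (b y) + b x"
proof -
  let ?P = "\<lambda>q. \<forall>y. inner q (b y) = 0"
  \<comment> \<open>Left indices run through \<open>b\<close>, right indices through the orthogonal
    complement of its range. A right index outside the complement is sent to 0, which affects
    neither spans nor Gram matrices.\<close>
  define f where "f = case_sum b (\<lambda>q. if ?P q then q else 0)"
  define g where "g x = case_sum (\<lambda>y. b (x + y) - b x) (\<lambda>q. if ?P q then q else 0)" for x
  have "range b \<union> {q. \<forall>a\<in>range b. inner q a = 0} \<subseteq> range f"
  proof
    fix v assume "v \<in> range b \<union> {q. \<forall>a\<in>range b. inner q a = 0}"
    then have "(\<exists>y. v = f (Inl y)) \<or> v = f (Inr v)" by (auto simp: f_def)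
    then show "v \<in> range f" by blast
  qed
  then have dense: "closure (span (range f)) = UNIV"
    using closure_mono[OF span_mono] closure_span_Un_orthogonal[of "range b"] by blast
  have gram_g: "inner (f i) (f j) = inner (g x i) (g x j)" for x i j
  proof -
    \<comment> \<open>Squared distances \<open>\<psi> (y - z)\<close> do not change when
      \<open>y\<close> and \<open>z\<close> are translated by \<open>x\<close>; subtracting
      \<open>b x\<close> restores the base point 0.\<close>
    have 1: "inner (b (x + y) - b x) (b (x + z) - b x) = inner (b y) (b z)" for y z
    proof -
      have "\<psi> 0 = 0" using gram[of 0 0] 0 by simp
      then show ?thesis
        using \<psi>[of y] \<psi>[of z]
        by (simp add: inner_diff_left inner_diff_right gram diff_divide_distrib add_divide_distrib)
    qed
    have 2: "inner (b y) (if ?P q then q else 0) = 0" "inner (if ?P q then q else 0) (b y) = 0" for q y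
      by (simp_all add: inner_commute[of "b y"])
    show ?thesis
      using 1[symmetric]
      by (cases i; cases j) (simp_all only: f_def g_def sum.case 2 inner_diff_left[of _ _ "if _ then _ else _"]
          inner_diff_right[of "if _ then _ else _"] diff_zero)
  qed
  have "\<exists>T. linear T \<and> (\<forall>v. norm (T v) = norm v) \<and> (\<forall>i. T (f i) = g x i)" for x
    using isometry_extension[OF gram_g dense] by metis
  then obtain \<pi> where lin: "\<And>x. linear (\<pi> x)" and iso: "\<And>x v. norm (\<pi> x v) = norm v"
    and \<pi>f: "\<And>x i. \<pi> x (f i) = g x i" by metis
  have \<pi>b: "\<pi> x (b y) = b (x + y) - b x" for x y
    using \<pi>f[of x "Inl y"] by (simp add: f_def g_def)
  have \<pi>q: "\<pi> x q = q" if "?P q" for x q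
    using \<pi>f[of x "Inr q"] that by (simp add: f_def g_def)
  have cases: "(\<exists>y. f i = b y) \<or> ?P (f i)" for i
    by (cases i) (auto simp: f_def)
  have rep: "isometric_representation \<pi>"
    unfolding isometric_representation_def
  proof (intro conjI allI lin iso)
    show "\<pi> 0 = id"
    proof (rule isometries_eqI[OF dense lin iso linear_id])
      show "\<pi> 0 (f i) = id (f i)" for i
        using cases[of i] by (auto simp: \<pi>b \<pi>q 0)
    qed simp
    show "\<pi> (x + y) = \<pi> x \<circ> \<pi> y" for x y
    proof (rule isometries_eqI[OF dense lin iso linear_compose[OF lin lin]])
      show "\<pi> (x + y) (f i) = (\<pi> x \<circ> \<pi> y) (f i)" for i
        using cases[of i] by (auto simp: \<pi>b \<pi>q linear_diff[OF lin] add.assoc)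
    qed (simp add: iso)
  qed
  have "continuous_on UNIV (\<lambda>x. \<pi> x v)" for v
    using dense
  proof (rule dense_span_induct[where P = "\<lambda>v. continuous_on UNIV (\<lambda>x. \<pi> x v)"])
    show "subspace {v. continuous_on UNIV (\<lambda>x. \<pi> x v)}"
      by (auto simp: subspace_def linear_0[OF lin] linear_add[OF lin] linear_scale[OF lin]
          intro!: continuous_intros)
    show "closed {v. continuous_on UNIV (\<lambda>x. \<pi> x v)}"
      unfolding closed_sequential_limits mem_Collect_eq
    proof (intro allI impI, elim conjE)
      fix u l assume u: "\<forall>n. continuous_on UNIV (\<lambda>x. \<pi> x (u n))" "u \<longlonglongrightarrow> l"
      have "dist (\<pi> x (u n)) (\<pi> x l) = dist (u n) l" for x n
        by (simp add: dist_norm linear_diff[OF lin, symmetric] iso)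
      \<comment> \<open>All \<open>\<pi> x\<close> are isometries, so the approximation of
        \<open>l\<close> by \<open>u n\<close> is uniform in \<open>x\<close>.\<close>
      then have "uniform_limit UNIV (\<lambda>n x. \<pi> x (u n)) (\<lambda>x. \<pi> x l) sequentially"
        unfolding uniform_limit_iff using u(2) by (simp add: tendsto_iff)
      then show "continuous_on UNIV (\<lambda>x. \<pi> x l)"
        by (rule uniform_limit_theorem[rotated]) (use u(1) in simp_all)
    qed
    show "continuous_on UNIV (\<lambda>x. \<pi> x (f i))" for i
      using cases[of i]
    proof
      assume "\<exists>y. f i = b y"
      then obtain y where y: "f i = b y" by blast
      have "continuous_on UNIV (\<lambda>x. b (x + y) - b x)"
        by (intro continuous_intros cont continuous_on_compose2[OF cont]) auto
      then show ?thesis by (simp add: y \<pi>b)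
    qed (simp add: \<pi>q)
  qed
  then have "strongly_continuous \<pi>" by (simp add: strongly_continuous_def)
  with rep show thesis by (rule that) (simp add: \<pi>b)
qed

section \<open>The mean distance and recentring\<close>

text \<open>The \<open>L2\<close> pseudodistance for the finitely additive measure \<open>M\<close>.
  It is meaningful for maps at bounded distance from each other, even if both are unbounded.\<close>

definition mean_dist :: "(('a \<Rightarrow> real) \<Rightarrow> real) \<Rightarrow> ('a \<Rightarrow> 'h::real_inner) \<Rightarrow> ('a \<Rightarrow> 'h) \<Rightarrow> real" where
  "mean_dist M g h = sqrt (M (\<lambda>z. (norm (g z - h z))\<^sup>2))"

lemma mean_dist_sq:
  assumes "is_mean M" "bounded (range (\<lambda>z. g z - h z))"
  shows "(mean_dist M g h)\<^sup>2 = M (\<lambda>z. (norm (g z - h z))\<^sup>2)"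
  using mean_nonneg[OF assms(1) bounded_range_norm_sq[OF assms(2)]] by (simp add: mean_dist_def)

lemma mean_dist_nonneg:
  assumes "is_mean M" "bounded (range (\<lambda>z. g z - h z))"
  shows "0 \<le> mean_dist M g h"
  using mean_nonneg[OF assms(1) bounded_range_norm_sq[OF assms(2)]] by (simp add: mean_dist_def)

lemma mean_dist_commute: "mean_dist M g h = mean_dist M h g"
  by (simp add: mean_dist_def norm_minus_commute)

lemma mean_dist_shift:
  assumes "is_mean M" "\<And>f x. bounded (range f) \<Longrightarrow> M (\<lambda>z. f (z + x)) = M f"
    and "bounded (range (\<lambda>z. g z - h z))"
  shows "mean_dist M (\<lambda>z. g (z + x)) (\<lambda>z. h (z + x)) = mean_dist M g h"
  using assms(2)[OF bounded_range_norm_sq[OF assms(3)], of x] by (simp add: mean_dist_def)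

lemma bounded_range_diff_commute:
  fixes g h :: "'a \<Rightarrow> 'h::real_normed_vector"
  shows "bounded (range (\<lambda>z. g z - h z)) \<Longrightarrow> bounded (range (\<lambda>z. h z - g z))"
  by (simp add: bounded_iff norm_minus_commute)

lemma bounded_range_diff_trans:
  fixes g h k :: "'a \<Rightarrow> 'h::real_normed_vector"
  assumes "bounded (range (\<lambda>z. g z - h z))" "bounded (range (\<lambda>z. h z - k z))"
  shows "bounded (range (\<lambda>z. g z - k z))"
  using bounded_range_add[OF assms] by simp

lemma mean_dist_le:
  assumes M: "is_mean M" and bd: "bounded (range (\<lambda>z. g z - h z))"
    and le: "\<And>z. norm (g z - h z) \<le> B"
  shows "mean_dist M g h \<le> B"
proof -
  have B: "0 \<le> B" using le[of undefined] norm_ge_zero order_trans by blast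
  have "(norm (g z - h z))\<^sup>2 \<le> B\<^sup>2" for z using le by (intro power_mono) auto
  then have "M (\<lambda>z. (norm (g z - h z))\<^sup>2) \<le> M (\<lambda>_. B\<^sup>2)"
    by (intro mean_mono[OF M] bounded_range_norm_sq bd) auto
  then show ?thesis
    using B mean_const[OF M, of "B\<^sup>2"] by (simp add: mean_dist_def real_le_lsqrt)
qed

lemma mean_dist_ge:
  assumes M: "is_mean M" and bd: "bounded (range (\<lambda>z. g z - h z))"
    and B: "0 \<le> B" and le: "\<And>z. B \<le> norm (g z - h z)"
  shows "B \<le> mean_dist M g h"
proof -
  have "B\<^sup>2 \<le> (norm (g z - h z))\<^sup>2" for z using le B by (intro power_mono) auto
  then have "M (\<lambda>_. B\<^sup>2) \<le> M (\<lambda>z. (norm (g z - h z))\<^sup>2)"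
    by (intro mean_mono[OF M] bounded_range_norm_sq bd) auto
  then show ?thesis
    using B mean_const[OF M, of "B\<^sup>2"] by (simp add: mean_dist_def real_le_rsqrt)
qed

text \<open>Minkowski's inequality, from \<open>\<parallel>u + v\<parallel>\<^sup>2 \<le> (1 + b / a) \<parallel>u\<parallel>\<^sup>2 + (1 + a / b) \<parallel>v\<parallel>\<^sup>2\<close> with
  \<open>a\<close>, \<open>b\<close> slightly larger than the two seminorms.\<close>

lemma mean_dist_triangle:
  assumes M: "is_mean M"
    and gh: "bounded (range (\<lambda>z. g z - h z))" and hk: "bounded (range (\<lambda>z. h z - k z))"
  shows "mean_dist M g k \<le> mean_dist M g h + mean_dist M h k"
proof (rule field_le_epsilon)
  fix e :: real assume e: "0 < e"
  define a where "a = mean_dist M g h + e / 2"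
  define b where "b = mean_dist M h k + e / 2"
  have pos: "0 < a" "0 < b"
    using mean_dist_nonneg[OF M gh] mean_dist_nonneg[OF M hk] e by (simp_all add: a_def b_def)
  have gk: "bounded (range (\<lambda>z. g z - k z))" using gh hk by (rule bounded_range_diff_trans)
  have young: "(norm (u + v))\<^sup>2 \<le> (1 + b / a) * (norm u)\<^sup>2 + (1 + a / b) * (norm v)\<^sup>2" for u v :: 'b
  proof -
    have "0 \<le> (norm (b *\<^sub>R u - a *\<^sub>R v))\<^sup>2 / (a * b)" using pos by simp
    also have "\<dots> = b / a * (norm u)\<^sup>2 - 2 * inner u v + a / b * (norm v)\<^sup>2"
      using pos unfolding power2_norm_eq_inner
      by (simp add: inner_simps inner_commute[of v u] field_simps)
    finally show ?thesis
      unfolding power2_norm_eq_inner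
      by (simp add: inner_add_left inner_add_right inner_commute[of v u] algebra_simps)
  qed
  have "(mean_dist M g k)\<^sup>2 = M (\<lambda>z. (norm ((g z - h z) + (h z - k z)))\<^sup>2)"
    using mean_dist_sq[OF M gk] by simp
  moreover have "M (\<lambda>z. (norm ((g z - h z) + (h z - k z)))\<^sup>2) \<le>
      M (\<lambda>z. (1 + b / a) * (norm (g z - h z))\<^sup>2 + (1 + a / b) * (norm (h z - k z))\<^sup>2)"
    by (rule mean_mono[OF M _ _ young])
       (intro bounded_range_norm_sq bounded_range_add bounded_range_cmult gh hk)+
  moreover have "M (\<lambda>z. (1 + b / a) * (norm (g z - h z))\<^sup>2 + (1 + a / b) * (norm (h z - k z))\<^sup>2) =
      (1 + b / a) * (mean_dist M g h)\<^sup>2 + (1 + a / b) * (mean_dist M h k)\<^sup>2"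
    by (simp only: mean_dist_sq[OF M] mean_add[OF M] mean_cmult[OF M] gh hk bounded_range_norm_sq
        bounded_range_cmult)
  moreover have "\<dots> \<le> (1 + b / a) * a\<^sup>2 + (1 + a / b) * b\<^sup>2"
    using pos e mean_dist_nonneg[OF M gh] mean_dist_nonneg[OF M hk]
    by (intro add_mono mult_left_mono power_mono) (auto simp: a_def b_def)
  moreover have "(1 + b / a) * a\<^sup>2 + (1 + a / b) * b\<^sup>2 = (a + b)\<^sup>2"
    using pos by (simp add: power2_eq_square field_simps)
  ultimately have "(mean_dist M g k)\<^sup>2 \<le> (a + b)\<^sup>2" by linarith
  then have "mean_dist M g k \<le> a + b" by (rule power2_le_imp_le) (use pos in simp)
  then show "mean_dist M g k \<le> mean_dist M g h + mean_dist M h k + e" by (simp add: a_def b_def)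
qed

text \<open>The parallelogram law, averaged. It is the uniform convexity behind the Chebyshev
  centres: if \<open>g\<close> and \<open>h\<close> are far apart, their midpoint is distinctly
  closer to \<open>k\<close> than the farther of the two.\<close>

lemma mean_dist_midpoint:
  assumes M: "is_mean M"
    and kg: "bounded (range (\<lambda>z. k z - g z))" and kh: "bounded (range (\<lambda>z. k z - h z))"
  shows "(mean_dist M k (\<lambda>z. (1 / 2) *\<^sub>R (g z + h z)))\<^sup>2 =
    (mean_dist M k g)\<^sup>2 / 2 + (mean_dist M k h)\<^sup>2 / 2 - (mean_dist M g h)\<^sup>2 / 4"
proof -
  have gh: "bounded (range (\<lambda>z. g z - h z))"
    using bounded_range_diff_trans[OF bounded_range_diff_commute[OF kg] kh] .
  have "k z - (1 / 2) *\<^sub>R (g z + h z) = (1 / 2) *\<^sub>R ((k z - g z) + (k z - h z))" for z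
    using scaleR_left_distrib[of "1 / 2" "1 / 2" "k z"] by (simp add: algebra_simps)
  then have kmid: "bounded (range (\<lambda>z. k z - (1 / 2) *\<^sub>R (g z + h z)))"
    using bounded_scaleR_comp[OF bounded_range_add[OF kg kh], of "1 / 2"] by simp
  have "(norm (k z - (1 / 2) *\<^sub>R (g z + h z)))\<^sup>2 =
      (1 / 2) * (norm (k z - g z))\<^sup>2 + (1 / 2) * (norm (k z - h z))\<^sup>2 - (1 / 4) * (norm (g z - h z))\<^sup>2" for z
    unfolding power2_norm_eq_inner by (simp add: inner_simps inner_commute field_simps)
  then have "(mean_dist M k (\<lambda>z. (1 / 2) *\<^sub>R (g z + h z)))\<^sup>2 =
      M (\<lambda>z. (1 / 2) * (norm (k z - g z))\<^sup>2 + (1 / 2) * (norm (k z - h z))\<^sup>2 - (1 / 4) * (norm (g z - h z))\<^sup>2)"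
    by (simp only: mean_dist_sq[OF M kmid])
  also have "\<dots> = (1 / 2) * (mean_dist M k g)\<^sup>2 + (1 / 2) * (mean_dist M k h)\<^sup>2 - (1 / 4) * (mean_dist M g h)\<^sup>2"
    by (simp only: mean_dist_sq[OF M] mean_add[OF M] mean_diff[OF M] mean_cmult[OF M] gh kg kh
        bounded_range_norm_sq bounded_range_cmult bounded_range_add)
  finally show ?thesis by simp
qed

text \<open>With \<open>u x\<close> the increment of \<open>g\<close> along \<open>x\<close>, the
  kernel is twice the averaged inner product of \<open>u x\<close> and \<open>u y\<close>, a Gram
  kernel. Invariance of \<open>M\<close> turns the increment along \<open>x - y\<close> into
  \<open>u x - u y\<close>.\<close>

lemma negative_type_mean_dist:
  fixes g :: "'a::real_vector \<Rightarrow> 'h::real_inner"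
  assumes M: "is_mean M" and inv: "\<And>f x. bounded (range f) \<Longrightarrow> M (\<lambda>z. f (z + x)) = M f"
    and g: "\<And>x. bounded (range (\<lambda>z. g (z + x) - g z))"
  shows "negative_type (\<lambda>x. (mean_dist M (\<lambda>z. g (z + x)) g)\<^sup>2)"
proof -
  define \<psi> where "\<psi> x = (mean_dist M (\<lambda>z. g (z + x)) g)\<^sup>2" for x
  define u where "u x z = g (z + x) - g z" for x z
  have u: "bounded (range (u x))" for x using g by (simp add: u_def)
  have \<psi>: "\<psi> x = M (\<lambda>z. (norm (u x z))\<^sup>2)" for x
    by (simp add: \<psi>_def u_def mean_dist_sq[OF M g])
  have diff: "\<psi> (x - y) = M (\<lambda>z. (norm (u x z - u y z))\<^sup>2)" for x y
  proof -
    have "u (x - y) (z + y) = u x z - u y z" for z by (simp add: u_def add_ac)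
    then show ?thesis
      using inv[OF bounded_range_norm_sq[OF u[of "x - y"]], of y] by (simp add: \<psi>)
  qed
  have 0: "\<psi> 0 = 0" by (simp add: \<psi> u_def mean_const[OF M])
  have gram: "\<psi> x + \<psi> y - \<psi> (x - y) = 2 * M (\<lambda>z. inner (u x z) (u y z))" for x y
  proof -
    have "(norm (u x z))\<^sup>2 + (norm (u y z))\<^sup>2 - (norm (u x z - u y z))\<^sup>2 = 2 * inner (u x z) (u y z)" for z
      by (simp add: power2_norm_eq_inner inner_simps inner_commute)
    moreover have "\<psi> x + \<psi> y - \<psi> (x - y) =
        M (\<lambda>z. (norm (u x z))\<^sup>2 + (norm (u y z))\<^sup>2 - (norm (u x z - u y z))\<^sup>2)"
      unfolding diff \<psi>[of x] \<psi>[of y]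
      by (simp only: mean_add[OF M] mean_diff[OF M] bounded_range_norm_sq bounded_range_add
          bounded_range_diff u)
    ultimately show ?thesis
      by (simp only: mean_cmult[OF M bounded_range_inner[OF u u]])
  qed
  have "0 \<le> (\<Sum>i<N. \<Sum>j<N. c i * c j * (\<psi> (x i) + \<psi> (x j) - \<psi> (x i - x j)))"
    for N :: nat and c :: "nat \<Rightarrow> real" and x
  proof -
    define w where "w z = (\<Sum>i<N. c i *\<^sub>R u (x i) z)" for z
    have w: "bounded (range w)"
      unfolding w_def by (intro bounded_range_sum bounded_scaleR_comp u)
    have c_mult: "M (\<lambda>z. c i * c j * inner (u (x i) z) (u (x j) z)) =
        c i * c j * M (\<lambda>z. inner (u (x i) z) (u (x j) z))" for i j
      by (rule mean_cmult[OF M bounded_range_inner[OF u u]])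
    have "(\<Sum>i<N. \<Sum>j<N. c i * c j * (\<psi> (x i) + \<psi> (x j) - \<psi> (x i - x j))) =
        2 * (\<Sum>i<N. \<Sum>j<N. M (\<lambda>z. c i * c j * inner (u (x i) z) (u (x j) z)))"
      unfolding c_mult gram by (simp add: sum_distrib_left mult_ac)
    moreover have "(\<Sum>i<N. \<Sum>j<N. M (\<lambda>z. c i * c j * inner (u (x i) z) (u (x j) z))) =
        M (\<lambda>z. \<Sum>i<N. \<Sum>j<N. c i * c j * inner (u (x i) z) (u (x j) z))"
      by (subst mean_sum[OF M], (intro bounded_range_sum bounded_range_cmult bounded_range_inner u)[1],
          subst mean_sum[OF M], (intro bounded_range_cmult bounded_range_inner u)[1], rule refl)
    moreover have "(\<lambda>z. \<Sum>i<N. \<Sum>j<N. c i * c j * inner (u (x i) z) (u (x j) z)) = (\<lambda>z. (norm (w z))\<^sup>2)"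
    proof
      fix z
      have "(norm (w z))\<^sup>2 = (\<Sum>i<N. \<Sum>j<N. inner (c i *\<^sub>R u (x i) z) (c j *\<^sub>R u (x j) z))"
        unfolding w_def power2_norm_eq_inner inner_sum_left
        by (intro sum.cong refl) (rule inner_sum_right)
      then show "(\<Sum>i<N. \<Sum>j<N. c i * c j * inner (u (x i) z) (u (x j) z)) = (norm (w z))\<^sup>2"
        by (simp add: mult_ac)
    qed
    ultimately show ?thesis using mean_nonneg[OF M bounded_range_norm_sq[OF w]] by simp
  qed
  \<comment> \<open>Evenness is \<open>gram\<close> at the pair \<open>0\<close>, \<open>x\<close>,
    where the increment \<open>u 0\<close> vanishes.\<close>
  moreover have "\<psi> (- x) = \<psi> x" for x
  proof -
    have "u 0 z = 0" for z by (simp add: u_def)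
    then show ?thesis using gram[of 0 x] by (simp add: 0 mean_const[OF M])
  qed
  ultimately show ?thesis using 0 unfolding negative_type_def \<psi>_def[symmetric] by simp
qed

text \<open>Every clause is an equation or a weak inequality between finitely many values, hence
  stable under pointwise limits.\<close>

lemma negative_type_limit:
  fixes \<psi> :: "'a::ab_group_add \<Rightarrow> real"
  assumes "\<And>n. negative_type (\<psi>n n)" "\<And>x. (\<lambda>n. \<psi>n n x) \<longlonglongrightarrow> \<psi> x"
  shows "negative_type \<psi>"
  unfolding negative_type_def
proof (intro conjI allI)
  show "\<psi> 0 = 0"
    using assms(2)[of 0] by (simp add: negative_type_0[OF assms(1)] LIMSEQ_const_iff)
  show "\<psi> (- x) = \<psi> x" for x
  proof (rule LIMSEQ_unique)
    show "(\<lambda>n. \<psi>n n x) \<longlonglongrightarrow> \<psi> (- x)"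
      using assms(2)[of "- x"] by (simp only: negative_type_minus[OF assms(1)])
  qed (rule assms(2))
  fix N :: nat and c :: "nat \<Rightarrow> real" and x :: "nat \<Rightarrow> 'a"
  let ?S = "\<lambda>\<psi> :: 'a \<Rightarrow> real. \<Sum>i<N. \<Sum>j<N. c i * c j * (\<psi> (x i) + \<psi> (x j) - \<psi> (x i - x j))"
  have lim: "(\<lambda>n. ?S (\<psi>n n)) \<longlonglongrightarrow> ?S \<psi>"
    by (intro tendsto_sum tendsto_mult_left tendsto_diff tendsto_add assms(2))
  have "\<exists>N. \<forall>n\<ge>N. 0 \<le> ?S (\<psi>n n)"
    by (intro exI allI impI) (rule negative_type_sum[OF assms(1)])
  with lim show "0 \<le> ?S \<psi>" by (rule LIMSEQ_le_const)
qed

lemma convergent_of_uniform_tail: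
  fixes f :: "nat \<Rightarrow> real"
  assumes "\<epsilon> \<longlonglongrightarrow> 0" "\<And>n m. n < m \<Longrightarrow> \<bar>f m - f n\<bar> \<le> \<epsilon> n"
  shows "convergent f"
proof (rule Cauchy_convergent, rule metric_CauchyI)
  fix e :: real assume "0 < e"
  then have "eventually (\<lambda>n. \<epsilon> n < e / 2) sequentially"
    using assms(1) by (intro order_tendstoD(2)) auto
  then obtain N where N: "\<epsilon> N < e / 2" unfolding eventually_sequentially by blast
  have "\<bar>f m - f N\<bar> < e / 2" if "m > N" for m using assms(2)[OF that] N by simp
  then have "dist (f m) (f n) < e" if "m \<ge> Suc N" "n \<ge> Suc N" for m n
    using that by (smt (verit) Suc_le_lessD dist_real_def field_sum_of_halves)
  then show "\<exists>M. \<forall>m\<ge>M. \<forall>n\<ge>M. dist (f m) (f n) < e" by blast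
qed

text \<open>Translation acts isometrically, for the mean distance, on the maps at bounded distance from
  \<open>\<sigma>\<close>. The orbit of \<open>\<sigma>\<close> need not be continuous, but the approximate Chebyshev centres \<open>g n\<close> of the
  pieces \<open>{\<sigma>(\<cdot> + y) | \<parallel>y\<parallel> \<le> (1/2)^n}\<close> of it become fixed by small translations as \<open>n\<close> grows, by uniform
  convexity. In the limit the orbit of the centre is continuous.\<close>

lemma recentring:
  fixes \<sigma> :: "'a::real_normed_vector \<Rightarrow> 'h::real_inner"
  assumes M: "is_mean M" and inv: "\<And>f x. bounded (range f) \<Longrightarrow> M (\<lambda>z. f (z + x)) = M f"
    and \<sigma>: "\<And>x. bounded (range (\<lambda>z. \<sigma> (z + x) - \<sigma> z))"
    and L: "\<And>x z. norm x \<le> 1 \<Longrightarrow> norm (\<sigma> (z + x) - \<sigma> z) \<le> L"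
  obtains \<psi> K where "negative_type \<psi>" "(\<psi> \<longlongrightarrow> 0) (at 0)"
    "\<And>x. mean_dist M (\<lambda>z. \<sigma> (z + x)) \<sigma> \<le> sqrt (\<psi> x) + K"
proof -
  define A where "A = {g :: 'a \<Rightarrow> 'h. bounded (range (\<lambda>z. g z - \<sigma> z))}"
  define \<tau> where "\<tau> x g = (\<lambda>z. g (z + x))" for x and g :: "'a \<Rightarrow> 'h"
  let ?D = "mean_dist M"
  have bd: "bounded (range (\<lambda>z. g z - h z))" if "g \<in> A" "h \<in> A" for g h
    using bounded_range_diff_trans[OF _ bounded_range_diff_commute] that by (auto simp: A_def)
  have \<sigma>A: "\<sigma> \<in> A" by (simp add: A_def)
  have \<tau>A: "\<tau> x g \<in> A" if "g \<in> A" for x g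
  proof -
    have "bounded (range (\<lambda>z. g (z + x) - \<sigma> (z + x)))"
      using bounded_range_shift[of "\<lambda>z. g z - \<sigma> z" x] that by (simp add: A_def)
    from bounded_range_diff_trans[OF this \<sigma>] show ?thesis by (simp add: A_def \<tau>_def)
  qed
  have \<tau>_iso: "?D (\<tau> x g) (\<tau> x h) = ?D g h" if "g \<in> A" "h \<in> A" for x g h
    unfolding \<tau>_def by (rule mean_dist_shift[OF M inv bd[OF that]])
  have tri: "?D g k \<le> ?D g h + ?D h k" if "g \<in> A" "h \<in> A" "k \<in> A" for g h k
    using that by (intro mean_dist_triangle[OF M] bd)
  have nonneg: "0 \<le> ?D g h" if "g \<in> A" "h \<in> A" for g h
    using that by (intro mean_dist_nonneg[OF M] bd)
  \<comment> \<open>The ball of squared radius \<open>c\<close> about \<open>g\<close> covers the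
    \<open>n\<close>-th piece of the orbit; \<open>\<rho> n\<close> is then the squared Chebyshev
    radius of that piece.\<close>
  define cov where "cov n g c \<longleftrightarrow> (\<forall>y. norm y \<le> (1 / 2) ^ n \<longrightarrow> (?D (\<tau> y \<sigma>) g)\<^sup>2 \<le> c)"
    for n :: nat and g c
  define \<rho> where "\<rho> n = Inf {c. \<exists>g\<in>A. cov n g c}" for n
  have cov_nonneg: "0 \<le> c" if "cov n g c" for n g c
    using that[unfolded cov_def, rule_format, of 0] by (simp add: order_trans[OF zero_le_power2])
  have bdd: "bdd_below {c. \<exists>g\<in>A. cov n g c}" for n
    using cov_nonneg by (intro bdd_belowI[of _ 0]) auto
  have "0 \<le> L" using L[of 0 0] by simp
  have "cov n \<sigma> (L\<^sup>2)" for n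
    unfolding cov_def
  proof (intro allI impI power_mono)
    fix y :: 'a assume "norm y \<le> (1 / 2) ^ n"
    then have "norm y \<le> 1" using power_le_one[of "1 / 2 :: real" n] by simp
    then show "?D (\<tau> y \<sigma>) \<sigma> \<le> L"
      using L by (intro mean_dist_le[OF M bd[OF \<tau>A[OF \<sigma>A] \<sigma>A]]) (simp add: \<tau>_def)
    show "0 \<le> ?D (\<tau> y \<sigma>) \<sigma>" by (intro nonneg \<tau>A \<sigma>A)
  qed
  then have ne: "{c. \<exists>g\<in>A. cov n g c} \<noteq> {}" for n using \<sigma>A by blast
  have \<rho>_le: "\<rho> n \<le> c" if "g \<in> A" "cov n g c" for n g c
    unfolding \<rho>_def using that by (intro cInf_lower bdd) blast
  have \<rho>0: "0 \<le> \<rho> n" for n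
    unfolding \<rho>_def using cov_nonneg by (intro cInf_greatest ne) auto
  have cov_Suc: "cov (Suc n) g c" if "cov n g c" for n g c
    using that unfolding cov_def
  proof (intro allI impI)
    fix y :: 'a assume n: "\<forall>y. norm y \<le> (1 / 2) ^ n \<longrightarrow> (?D (\<tau> y \<sigma>) g)\<^sup>2 \<le> c"
      and "norm y \<le> (1 / 2) ^ Suc n"
    moreover have "(1 / 2) ^ Suc n \<le> (1 / 2 :: real) ^ n" by simp
    ultimately show "(?D (\<tau> y \<sigma>) g)\<^sup>2 \<le> c" by (meson order_trans)
  qed
  have "decseq \<rho>"
    unfolding decseq_Suc_iff \<rho>_def using cov_Suc by (intro allI cInf_superset_mono ne bdd) blast
  then obtain r where r: "\<rho> \<longlonglongrightarrow> r" "\<And>n. r \<le> \<rho> n"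
    using decseq_convergent[of \<rho> 0] \<rho>0 by blast
  have "\<exists>g\<in>A. cov n g (\<rho> n + (1 / 2) ^ n)" for n
  proof -
    have "\<rho> n < \<rho> n + (1 / 2) ^ n" by simp
    then obtain c g where "g \<in> A" "cov n g c" "c < \<rho> n + (1 / 2) ^ n"
      unfolding \<rho>_def using cInf_less_iff[OF ne bdd] by blast
    then show ?thesis unfolding cov_def by (meson less_imp_le order_trans)
  qed
  then obtain g where gA: "\<And>n. g n \<in> A" and g: "\<And>n. cov n (g n) (\<rho> n + (1 / 2) ^ n)" by metis
  define \<epsilon> where "\<epsilon> n = sqrt (2 * (\<rho> n - r + 2 * (1 / 2) ^ n))" for n
  have \<epsilon>_lim: "\<epsilon> \<longlonglongrightarrow> 0"
  proof -
    have "(\<lambda>n. sqrt (2 * (\<rho> n - r + 2 * (1 / 2) ^ n))) \<longlonglongrightarrow> sqrt (2 * (r - r + 2 * 0))"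
      by (intro tendsto_intros r LIMSEQ_power_zero) simp
    then show ?thesis unfolding \<epsilon>_def by simp
  qed
  have key: "?D (\<tau> z (g n)) (g m) \<le> \<epsilon> n" if nm: "n < m" and z: "norm z \<le> (1 / 2) ^ Suc n" for n m z
  proof -
    let ?u = "\<tau> z (g n)" and ?v = "g m"
    define h where "h = (\<lambda>w. (1 / 2) *\<^sub>R (?u w + ?v w))"
    have uA: "?u \<in> A" by (intro \<tau>A gA)
    have hA: "h \<in> A"
    proof -
      have "h w - \<sigma> w = (1 / 2) *\<^sub>R ((?u w - \<sigma> w) + (?v w - \<sigma> w))" for w
        using scaleR_left_distrib[of "1 / 2" "1 / 2" "\<sigma> w"] by (simp add: h_def algebra_simps)
      then show ?thesis
        using bounded_scaleR_comp[OF bounded_range_add[OF bd[OF uA \<sigma>A] bd[OF gA[of m] \<sigma>A]], of "1 / 2"]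
        by (simp add: A_def)
    qed
    have pow: "(1 / 2) ^ m \<le> (1 / 2 :: real) ^ Suc n"
      using nm by (intro power_decreasing) auto
    \<comment> \<open>The \<open>m\<close>-th piece is covered from \<open>?v\<close> and also from
      \<open>?u\<close>, because its translate by \<open>- z\<close> lies in the \<open>n\<close>-th
      piece. So the midpoint \<open>h\<close> covers it with a smaller radius, but not below
      \<open>\<rho> m\<close>, which bounds the distance of \<open>?u\<close> and
      \<open>?v\<close>.\<close>
    have "cov m h ((\<rho> n + (1 / 2) ^ n) / 2 + (\<rho> m + (1 / 2) ^ m) / 2 - (?D ?u ?v)\<^sup>2 / 4)"
      unfolding cov_def
    proof (intro allI impI)
      fix y :: 'a assume y: "norm y \<le> (1 / 2) ^ m"
      have "norm (y - z) \<le> (1 / 2) ^ Suc n + (1 / 2) ^ Suc n"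
        using norm_triangle_ineq4[of y z] y z pow by linarith
      then have "norm (y - z) \<le> (1 / 2) ^ n" by simp
      then have 1: "(?D (\<tau> (y - z) \<sigma>) (g n))\<^sup>2 \<le> \<rho> n + (1 / 2) ^ n"
        using g[of n] unfolding cov_def by blast
      have "\<tau> z (\<tau> (y - z) \<sigma>) = \<tau> y \<sigma>" by (simp add: \<tau>_def add_ac)
      then have "?D (\<tau> (y - z) \<sigma>) (g n) = ?D (\<tau> y \<sigma>) ?u"
        using \<tau>_iso[OF \<tau>A[OF \<sigma>A] gA, of z "y - z" n] by simp
      with 1 have "(?D (\<tau> y \<sigma>) ?u)\<^sup>2 \<le> \<rho> n + (1 / 2) ^ n" by simp
      moreover have "(?D (\<tau> y \<sigma>) ?v)\<^sup>2 \<le> \<rho> m + (1 / 2) ^ m"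
        using g[of m] y unfolding cov_def by blast
      moreover have "(?D (\<tau> y \<sigma>) h)\<^sup>2 =
          (?D (\<tau> y \<sigma>) ?u)\<^sup>2 / 2 + (?D (\<tau> y \<sigma>) ?v)\<^sup>2 / 2 - (?D ?u ?v)\<^sup>2 / 4"
        unfolding h_def by (intro mean_dist_midpoint[OF M] bd \<tau>A \<sigma>A gA)
      ultimately show "(?D (\<tau> y \<sigma>) h)\<^sup>2 \<le>
          (\<rho> n + (1 / 2) ^ n) / 2 + (\<rho> m + (1 / 2) ^ m) / 2 - (?D ?u ?v)\<^sup>2 / 4"
        by (simp only: diff_right_mono add_mono divide_right_mono zero_le_numeral)
    qed
    from \<rho>_le[OF hA this] have "(?D ?u ?v)\<^sup>2 \<le> 2 * (\<rho> n - \<rho> m + (1 / 2) ^ n + (1 / 2) ^ m)"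
      by (simp add: field_simps)
    also have "\<dots> \<le> 2 * (\<rho> n - r + 2 * (1 / 2) ^ n)"
    proof -
      have "2 * (\<rho> n - \<rho> m + a + b) \<le> 2 * (\<rho> n - r + 2 * a)" if "b \<le> a" for a b
        using r(2)[of m] that by simp
      then show ?thesis using nm by (simp add: power_decreasing)
    qed
    finally show ?thesis unfolding \<epsilon>_def by (rule real_le_rsqrt)
  qed
  have \<tau>0: "\<tau> 0 h = h" for h by (simp add: \<tau>_def)
  have gg: "?D (g n) (g m) \<le> \<epsilon> n" if "n < m" for n m
    using key[OF that, of 0] by (simp add: \<tau>0)
  define \<phi> where "\<phi> n x = ?D (\<tau> x (g n)) (g n)" for n x
  have close: "\<bar>\<phi> m x - \<phi> n x\<bar> \<le> 2 * \<epsilon> n" if "n < m" for n m x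
  proof -
    have "\<phi> i x \<le> ?D (g i) (g j) + (\<phi> j x + ?D (g j) (g i))" for i j
    proof -
      have "?D (\<tau> x (g i)) (g i) \<le> ?D (\<tau> x (g i)) (\<tau> x (g j)) + ?D (\<tau> x (g j)) (g i)"
        by (intro tri \<tau>A gA)
      moreover have "?D (\<tau> x (g j)) (g i) \<le> ?D (\<tau> x (g j)) (g j) + ?D (g j) (g i)"
        by (intro tri \<tau>A gA)
      ultimately show ?thesis by (simp add: \<phi>_def \<tau>_iso gA)
    qed
    from this[of m n] this[of n m] show ?thesis
      using gg[OF that] mean_dist_commute[of M "g m" "g n"] by linarith
  qed
  have "convergent (\<lambda>n. \<phi> n x)" for x
    using tendsto_mult[OF tendsto_const[of 2] \<epsilon>_lim] close
    by (intro convergent_of_uniform_tail[of "\<lambda>n. 2 * \<epsilon> n"]) simp_all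
  then obtain \<Phi> where \<Phi>: "\<And>x. (\<lambda>n. \<phi> n x) \<longlonglongrightarrow> \<Phi> x" unfolding convergent_def by metis
  have \<phi>0: "0 \<le> \<phi> n x" for n x by (simp add: \<phi>_def nonneg \<tau>A gA)
  then have \<Phi>0: "0 \<le> \<Phi> x" for x
    by (intro LIMSEQ_le_const[OF \<Phi>]) auto
  \<comment> \<open>For \<open>n < m\<close>, both \<open>\<tau> z (g m)\<close> and
    \<open>g m\<close> are within \<open>\<epsilon> n\<close> of
    \<open>\<tau> z (g n)\<close>.\<close>
  have near: "\<Phi> z \<le> 2 * \<epsilon> n" if z: "norm z \<le> (1 / 2) ^ Suc n" for z n
  proof (rule LIMSEQ_le_const2[OF \<Phi>], intro exI allI impI)
    fix m assume "Suc n \<le> m"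
    then have nm: "n < m" by simp
    have "\<phi> m z \<le> ?D (\<tau> z (g m)) (\<tau> z (g n)) + ?D (\<tau> z (g n)) (g m)"
      unfolding \<phi>_def by (intro tri \<tau>A gA)
    then show "\<phi> m z \<le> 2 * \<epsilon> n"
      using gg[OF nm] key[OF nm z] by (simp add: \<tau>_iso gA mean_dist_commute[of M "g m"])
  qed
  \<comment> \<open>Each \<open>g n\<close> covers \<open>\<sigma>\<close> itself with squared
    radius at most \<open>\<rho> 0 + 1\<close>; the triangle inequality uses this radius
    twice.\<close>
  define K where "K = 2 * sqrt (\<rho> 0 + 1)"
  have far: "?D (\<tau> x \<sigma>) \<sigma> \<le> \<Phi> x + K" for x
  proof (rule LIMSEQ_le_const[OF tendsto_add[OF \<Phi> tendsto_const]], intro exI allI impI)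
    fix n :: nat
    have "(?D \<sigma> (g n))\<^sup>2 \<le> \<rho> n + (1 / 2) ^ n"
      using g[of n, unfolded cov_def, rule_format, of 0] by (simp add: \<tau>0)
    also have "\<rho> n \<le> \<rho> 0" using \<open>decseq \<rho>\<close> by (simp add: decseq_def)
    also have "(1 / 2 :: real) ^ n \<le> 1" by (simp add: power_le_one)
    finally have 1: "?D \<sigma> (g n) \<le> sqrt (\<rho> 0 + 1)" by (intro real_le_rsqrt) simp
    have "?D (\<tau> x \<sigma>) \<sigma> \<le> ?D (\<tau> x \<sigma>) (\<tau> x (g n)) + ?D (\<tau> x (g n)) \<sigma>"
      by (intro tri \<tau>A gA \<sigma>A)
    moreover have "?D (\<tau> x (g n)) \<sigma> \<le> \<phi> n x + ?D (g n) \<sigma>"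
      unfolding \<phi>_def by (intro tri \<tau>A gA \<sigma>A)
    ultimately show "?D (\<tau> x \<sigma>) \<sigma> \<le> \<phi> n x + K"
      using 1 by (simp add: \<tau>_iso gA \<sigma>A K_def mean_dist_commute[of M "g n"])
  qed
  have "negative_type (\<lambda>x. (\<phi> n x)\<^sup>2)" for n
    using negative_type_mean_dist[OF M inv, of "g n"] bd[OF \<tau>A[OF gA] gA] by (simp add: \<phi>_def \<tau>_def)
  then have neg: "negative_type (\<lambda>x. (\<Phi> x)\<^sup>2)"
    by (rule negative_type_limit[of "\<lambda>n x. (\<phi> n x)\<^sup>2"]) (intro tendsto_power \<Phi>)
  have "(\<Phi> \<longlongrightarrow> 0) (at 0)"
  proof (rule LIM_I)
    fix e :: real assume "0 < e"
    then have "eventually (\<lambda>n. \<epsilon> n < e / 2) sequentially"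
      using \<epsilon>_lim by (intro order_tendstoD(2)) auto
    then obtain n where n: "\<epsilon> n < e / 2" unfolding eventually_sequentially by blast
    have "norm (\<Phi> x - 0) < e" if "norm (x - 0) < (1 / 2) ^ Suc n" for x
      using near[of x n] that n \<Phi>0[of x] by simp
    then show "\<exists>s>0. \<forall>x. x \<noteq> 0 \<and> norm (x - 0) < s \<longrightarrow> norm (\<Phi> x - 0) < e"
      by (intro exI[of _ "(1 / 2) ^ Suc n"]) simp
  qed
  then have "((\<lambda>x. (\<Phi> x)\<^sup>2) \<longlongrightarrow> 0\<^sup>2) (at 0)" by (rule tendsto_power)
  then have lim: "((\<lambda>x. (\<Phi> x)\<^sup>2) \<longlongrightarrow> 0) (at 0)" by simp
  show thesis
  proof (rule that[OF neg lim])
    show "?D (\<lambda>z. \<sigma> (z + x)) \<sigma> \<le> sqrt ((\<Phi> x)\<^sup>2) + K" for x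
      using far[of x] \<Phi>0[of x] by (simp add: \<tau>_def)
  qed
qed

section \<open>Functions of negative type from maps into Hilbert spaces\<close>

lemma le_compression_modulus_iff:
  "ereal c \<le> compression_modulus \<sigma> t \<longleftrightarrow> (\<forall>a b. t \<le> dist a b \<longrightarrow> c \<le> dist (\<sigma> a) (\<sigma> b))"
  unfolding compression_modulus_def le_Inf_iff by (auto simp flip: ereal_less_eq(3))

lemma expansion_modulus_le_iff:
  "expansion_modulus \<sigma> t \<le> ereal c \<longleftrightarrow> (\<forall>a b. dist a b \<le> t \<longrightarrow> dist (\<sigma> a) (\<sigma> b) \<le> c)"
  unfolding expansion_modulus_def Sup_le_iff by (auto simp flip: ereal_less_eq(3))

lemma compression_modulus_pos_iff:
  "0 < compression_modulus \<sigma> t \<longleftrightarrow> (\<exists>\<delta>>0. \<forall>a b. t \<le> dist a b \<longrightarrow> \<delta> \<le> dist (\<sigma> a) (\<sigma> b))"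
proof
  assume "0 < compression_modulus \<sigma> t"
  then obtain \<delta> where "0 < ereal \<delta>" "ereal \<delta> < compression_modulus \<sigma> t"
    using ereal_dense2 by blast
  then have "0 < \<delta>" "ereal \<delta> \<le> compression_modulus \<sigma> t" by simp_all
  then show "\<exists>\<delta>>0. \<forall>a b. t \<le> dist a b \<longrightarrow> \<delta> \<le> dist (\<sigma> a) (\<sigma> b)"
    unfolding le_compression_modulus_iff by blast
next
  assume "\<exists>\<delta>>0. \<forall>a b. t \<le> dist a b \<longrightarrow> \<delta> \<le> dist (\<sigma> a) (\<sigma> b)"
  then obtain \<delta> where "0 < \<delta>" "ereal \<delta> \<le> compression_modulus \<sigma> t"
    unfolding le_compression_modulus_iff by blast
  then show "0 < compression_modulus \<sigma> t" by (metis ereal_less(2) less_le_trans)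
qed

lemma bornologous_iff:
  "bornologous \<sigma> \<longleftrightarrow> (\<forall>t. \<exists>B. \<forall>a b. dist a b \<le> t \<longrightarrow> dist (\<sigma> a) (\<sigma> b) \<le> B)"
proof -
  have "expansion_modulus \<sigma> t < \<infinity> \<longleftrightarrow> (\<exists>B. expansion_modulus \<sigma> t \<le> ereal B)" for t
    by (cases "expansion_modulus \<sigma> t") auto
  then show ?thesis unfolding bornologous_def expansion_modulus_le_iff by simp
qed

lemma compression_modulus_mono: "s \<le> t \<Longrightarrow> compression_modulus \<sigma> s \<le> compression_modulus \<sigma> t"
  unfolding compression_modulus_def by (intro Inf_superset_mono) (auto intro: order_trans)

lemma expanding_iff:
  "expanding \<sigma> \<longleftrightarrow> (\<forall>K. \<exists>R. \<forall>a b. R \<le> dist a b \<longrightarrow> K \<le> dist (\<sigma> a) (\<sigma> b))"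
proof
  assume ex: "expanding \<sigma>"
  show "\<forall>K. \<exists>R. \<forall>a b. R \<le> dist a b \<longrightarrow> K \<le> dist (\<sigma> a) (\<sigma> b)"
  proof
    fix K
    have "eventually (\<lambda>t. ereal K < compression_modulus \<sigma> t) at_top"
      using ex unfolding expanding_def tendsto_PInfty by blast
    then obtain R where "ereal K < compression_modulus \<sigma> R"
      unfolding eventually_at_top_linorder by blast
    then show "\<exists>R. \<forall>a b. R \<le> dist a b \<longrightarrow> K \<le> dist (\<sigma> a) (\<sigma> b)"
      unfolding le_compression_modulus_iff[symmetric] using less_imp_le by blast
  qed
next
  assume ex: "\<forall>K. \<exists>R. \<forall>a b. R \<le> dist a b \<longrightarrow> K \<le> dist (\<sigma> a) (\<sigma> b)"
  show "expanding \<sigma>"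
    unfolding expanding_def tendsto_PInfty
  proof
    fix K
    obtain R where "ereal (K + 1) \<le> compression_modulus \<sigma> R"
      using ex unfolding le_compression_modulus_iff by blast
    then have "ereal K < compression_modulus \<sigma> R"
      by (rule less_le_trans[rotated]) simp
    then have "ereal K < compression_modulus \<sigma> t" if "R \<le> t" for t
      using compression_modulus_mono[OF that] by (rule less_le_trans)
    then show "eventually (\<lambda>t. ereal K < compression_modulus \<sigma> t) at_top"
      unfolding eventually_at_top_linorder by blast
  qed
qed

section \<open>Operations that preserve negative type\<close>

lemma negative_type_scale:
  assumes "negative_type \<psi>" "0 \<le> c"
  shows "negative_type (\<lambda>x. c * \<psi> x)"
proof -
  have "(\<Sum>i<N. \<Sum>j<N. a i * a j * (c * \<psi> (x i) + c * \<psi> (x j) - c * \<psi> (x i - x j))) =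
      c * (\<Sum>i<N. \<Sum>j<N. a i * a j * (\<psi> (x i) + \<psi> (x j) - \<psi> (x i - x j)))" for N :: nat and a x
    by (simp add: sum_distrib_left algebra_simps)
  then show ?thesis
    using assms negative_type_sum[OF assms(1)] unfolding negative_type_def by simp
qed

lemma negative_type_add:
  assumes "negative_type \<psi>" "negative_type \<phi>"
  shows "negative_type (\<lambda>x. \<psi> x + \<phi> x)"
proof -
  have "(\<Sum>i<N. \<Sum>j<N. a i * a j * (\<psi> (x i) + \<phi> (x i) + (\<psi> (x j) + \<phi> (x j)) - (\<psi> (x i - x j) + \<phi> (x i - x j)))) =
      (\<Sum>i<N. \<Sum>j<N. a i * a j * (\<psi> (x i) + \<psi> (x j) - \<psi> (x i - x j))) +
      (\<Sum>i<N. \<Sum>j<N. a i * a j * (\<phi> (x i) + \<phi> (x j) - \<phi> (x i - x j)))" for N :: nat and a x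
    by (simp add: sum.distrib[symmetric] algebra_simps)
  then show ?thesis
    using assms negative_type_sum[OF assms(1)] negative_type_sum[OF assms(2)]
    unfolding negative_type_def by simp
qed

lemma negative_type_dilation:
  fixes \<psi> :: "'a::real_vector \<Rightarrow> real"
  assumes "negative_type \<psi>" shows "negative_type (\<lambda>x. \<psi> (c *\<^sub>R x))"
  unfolding negative_type_def
  using negative_type_sum[OF assms, where x = "\<lambda>i. c *\<^sub>R x i" for x :: "nat \<Rightarrow> 'a"]
  by (simp add: negative_type_0[OF assms] negative_type_minus[OF assms] scaleR_diff_right)

lemma negative_type_suminf:
  fixes \<psi> :: "nat \<Rightarrow> 'a::ab_group_add \<Rightarrow> real"
  assumes "\<And>n. negative_type (\<psi> n)" "\<And>x. summable (\<lambda>n. \<psi> n x)"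
  shows "negative_type (\<lambda>x. \<Sum>n. \<psi> n x)"
proof (rule negative_type_limit)
  show "negative_type (\<lambda>x. \<Sum>n<N. \<psi> n x)" for N
  proof (induction N)
    case 0
    show ?case by (simp add: negative_type_def)
  next
    case (Suc N)
    then show ?case using negative_type_add[OF Suc assms(1)] by simp
  qed
  show "(\<lambda>N. \<Sum>n<N. \<psi> n x) \<longlonglongrightarrow> (\<Sum>n. \<psi> n x)" for x
    by (rule summable_LIMSEQ[OF assms(2)])
qed

text \<open>Recentring gives continuity at 0 and costs only an additive constant in the square root.
  The mean distance between \<open>\<sigma>\<close> and its translate by \<open>x\<close> is at
  least the compression modulus at \<open>norm x\<close>, so it tends to infinity.\<close>

lemma coarse_embedding_negative_type:
  fixes \<sigma> :: "'a::real_normed_vector \<Rightarrow> 'h::real_inner"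
  assumes "coarse_embedding \<sigma>"
  obtains \<psi> :: "'a \<Rightarrow> real"
  where "negative_type \<psi>" "(\<psi> \<longlongrightarrow> 0) (at 0)" "filterlim \<psi> at_top at_infinity"
proof -
  obtain M :: "('a \<Rightarrow> real) \<Rightarrow> real"
    where M: "is_mean M" and inv: "\<And>f x. bounded (range f) \<Longrightarrow> M (\<lambda>z. f (z + x)) = M f"
    using invariant_mean_exists by blast
  have up: "\<exists>B. \<forall>z x. norm x \<le> t \<longrightarrow> norm (\<sigma> (z + x) - \<sigma> z) \<le> B" for t
  proof -
    obtain B where "\<forall>a b. dist a b \<le> t \<longrightarrow> dist (\<sigma> a) (\<sigma> b) \<le> B"
      using assms unfolding coarse_embedding_def bornologous_iff by blast
    then show ?thesis by (intro exI[of _ B]) (simp add: dist_norm)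
  qed
  have bd: "bounded (range (\<lambda>z. \<sigma> (z + x) - \<sigma> z))" for x
    using up[of "norm x"] unfolding bounded_iff by blast
  obtain L where L: "\<And>z x. norm x \<le> 1 \<Longrightarrow> norm (\<sigma> (z + x) - \<sigma> z) \<le> L"
    using up[of 1] by blast
  from recentring[OF M inv bd L] obtain \<psi> K where \<psi>: "negative_type \<psi>" "(\<psi> \<longlongrightarrow> 0) (at 0)"
    and K: "\<And>x. mean_dist M (\<lambda>z. \<sigma> (z + x)) \<sigma> \<le> sqrt (\<psi> x) + K" by metis
  have "filterlim \<psi> at_top at_infinity"
    unfolding filterlim_at_top
  proof
    fix Z :: real
    \<comment> \<open>The maximum with 0 is there because \<open>mean_dist_ge\<close> asks for a
      nonnegative bound and the sign of \<open>K\<close> is not known.\<close>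
    obtain R where R: "\<And>a b. R \<le> dist a b \<Longrightarrow> max 0 (K + sqrt \<bar>Z\<bar>) \<le> dist (\<sigma> a) (\<sigma> b)"
      using assms unfolding coarse_embedding_def expanding_iff by blast
    have "Z \<le> \<psi> x" if "R \<le> norm x" for x
    proof -
      have "max 0 (K + sqrt \<bar>Z\<bar>) \<le> norm (\<sigma> (z + x) - \<sigma> z)" for z
        using R[of "z + x" z] that by (simp add: dist_norm)
      then have "max 0 (K + sqrt \<bar>Z\<bar>) \<le> mean_dist M (\<lambda>z. \<sigma> (z + x)) \<sigma>"
        by (intro mean_dist_ge[OF M bd]) simp_all
      then have "K + sqrt \<bar>Z\<bar> \<le> mean_dist M (\<lambda>z. \<sigma> (z + x)) \<sigma>" by simp
      also have "\<dots> \<le> sqrt (\<psi> x) + K" by (rule K)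
      finally have "sqrt \<bar>Z\<bar> \<le> sqrt (\<psi> x)" by simp
      then show ?thesis by simp
    qed
    then show "eventually (\<lambda>x. Z \<le> \<psi> x) at_infinity"
      unfolding eventually_at_infinity by blast
  qed
  with \<psi> show thesis by (rule that)
qed

text \<open>Splitting \<open>x\<close> into \<open>n\<close> steps so short that each moves
  \<open>\<sigma>\<close> by less than 1 bounds the increment by \<open>n\<close>, uniformly in
  \<open>z\<close>.\<close>

lemma uniformly_continuous_increments_bounded:
  fixes \<sigma> :: "'a::real_normed_vector \<Rightarrow> 'h::real_normed_vector"
  assumes "uniformly_continuous_on UNIV \<sigma>"
  shows "bounded (range (\<lambda>z. \<sigma> (z + x) - \<sigma> z))"
proof -
  obtain d where d: "d > 0" "\<And>a b. dist a b < d \<Longrightarrow> dist (\<sigma> a) (\<sigma> b) < 1"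
    using assms unfolding uniformly_continuous_on_def by (metis UNIV_I zero_less_one)
  obtain n :: nat where n: "norm x / d < real n" using reals_Archimedean2 by blast
  then have n0: "0 < real n" using d(1) by (smt (verit) divide_nonneg_pos norm_ge_zero)
  define w where "w = (1 / real n) *\<^sub>R x"
  have w: "norm w < d" using n n0 d(1) by (simp add: w_def field_simps)
  have "norm (\<sigma> (z + real k *\<^sub>R w) - \<sigma> z) \<le> real k" for k z
  proof (induction k)
    case (Suc k)
    have "dist (\<sigma> (z + real (Suc k) *\<^sub>R w)) (\<sigma> (z + real k *\<^sub>R w)) < 1"
      using w by (intro d(2)) (simp add: dist_norm algebra_simps)
    then show ?case
      using Suc norm_triangle_ineq[of "\<sigma> (z + real (Suc k) *\<^sub>R w) - \<sigma> (z + real k *\<^sub>R w)"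
          "\<sigma> (z + real k *\<^sub>R w) - \<sigma> z"] by (simp add: dist_norm)
  qed simp
  from this[of _ n] have "norm (\<sigma> (z + x) - \<sigma> z) \<le> real n" for z
    using n0 by (simp add: w_def)
  then show ?thesis unfolding bounded_iff by blast
qed

text \<open>Increments along small vectors are small uniformly in the base point, so averaging
  \<open>\<sigma>\<close> itself already gives continuity at 0; averaging also keeps the lower
  bound.\<close>

lemma uncollapsed_negative_type:
  fixes \<sigma> :: "'a::real_normed_vector \<Rightarrow> 'h::real_inner"
  assumes uc: "uniformly_continuous_on UNIV \<sigma>" and "uncollapsed \<sigma>"
  obtains \<psi> :: "'a \<Rightarrow> real" and t \<delta> :: real
  where "negative_type \<psi>" "(\<psi> \<longlongrightarrow> 0) (at 0)" "0 < t" "0 < \<delta>" "\<And>x. t \<le> norm x \<Longrightarrow> \<delta> \<le> \<psi> x"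
proof -
  obtain M :: "('a \<Rightarrow> real) \<Rightarrow> real"
    where M: "is_mean M" and inv: "\<And>f x. bounded (range f) \<Longrightarrow> M (\<lambda>z. f (z + x)) = M f"
    using invariant_mean_exists by blast
  note bd = uniformly_continuous_increments_bounded[OF uc]
  define \<phi> where "\<phi> x = mean_dist M (\<lambda>z. \<sigma> (z + x)) \<sigma>" for x
  have \<phi>0: "0 \<le> \<phi> x" for x unfolding \<phi>_def by (rule mean_dist_nonneg[OF M bd])
  have neg: "negative_type (\<lambda>x. (\<phi> x)\<^sup>2)"
    using negative_type_mean_dist[OF M inv bd] by (simp add: \<phi>_def)
  have "(\<phi> \<longlongrightarrow> 0) (at 0)"
  proof (rule LIM_I)
    fix e :: real assume e: "0 < e"
    then obtain d where d: "d > 0" "\<And>a b. dist a b < d \<Longrightarrow> dist (\<sigma> a) (\<sigma> b) < e / 2"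
      using uc unfolding uniformly_continuous_on_def by (metis UNIV_I half_gt_zero)
    have "norm (\<phi> x - 0) < e" if "norm (x - 0) < d" for x
    proof -
      have "norm (\<sigma> (z + x) - \<sigma> z) \<le> e / 2" for z
        using d(2)[of "z + x" z] that by (simp add: dist_norm)
      then have "\<phi> x \<le> e / 2" unfolding \<phi>_def by (rule mean_dist_le[OF M bd])
      then show ?thesis using e \<phi>0[of x] by simp
    qed
    then show "\<exists>s>0. \<forall>x. x \<noteq> 0 \<and> norm (x - 0) < s \<longrightarrow> norm (\<phi> x - 0) < e"
      using d(1) by blast
  qed
  from tendsto_power[OF this, of 2] have lim: "((\<lambda>x. (\<phi> x)\<^sup>2) \<longlongrightarrow> 0) (at 0)" by simp
  obtain t \<delta> where t: "0 < t" and \<delta>: "0 < \<delta>"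
    and le: "\<And>a b. t \<le> dist a b \<Longrightarrow> \<delta> \<le> dist (\<sigma> a) (\<sigma> b)"
    using assms(2) unfolding uncollapsed_def compression_modulus_pos_iff by blast
  have "\<delta>\<^sup>2 \<le> (\<phi> x)\<^sup>2" if "t \<le> norm x" for x
  proof (rule power_mono)
    have "\<delta> \<le> norm (\<sigma> (z + x) - \<sigma> z)" for z
      using le[of "z + x" z] that by (simp add: dist_norm)
    then show "\<delta> \<le> \<phi> x"
      unfolding \<phi>_def using \<delta> by (intro mean_dist_ge[OF M bd]) simp_all
  qed (use \<delta> in simp)
  with \<delta> show thesis by (intro that[OF neg lim t, of "\<delta>\<^sup>2"]) simp_all
qed

text \<open>The factors \<open>l n\<close> are so small that the \<open>n\<close>-th dilation is at
  most \<open>(1 / 2) ^ n\<close> on the ball of radius \<open>n\<close>, which gives convergence.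
  Far out, any prescribed number of summands is at least \<open>\<delta>\<close>.\<close>

lemma negative_type_amplify:
  fixes \<psi> :: "'a::real_normed_vector \<Rightarrow> real"
  assumes \<psi>: "negative_type \<psi>" "(\<psi> \<longlongrightarrow> 0) (at 0)"
    and t: "0 < t" and \<delta>: "0 < \<delta>" and le: "\<And>x. t \<le> norm x \<Longrightarrow> \<delta> \<le> \<psi> x"
  obtains \<phi> :: "'a \<Rightarrow> real"
  where "negative_type \<phi>" "(\<phi> \<longlongrightarrow> 0) (at 0)" "filterlim \<phi> at_top at_infinity"
proof -
  have nn: "0 \<le> \<psi> x" for x by (rule negative_type_nonneg[OF \<psi>(1)])
  have "\<exists>l>0. \<forall>x. norm x \<le> real n \<longrightarrow> \<psi> (l *\<^sub>R x) \<le> (1 / 2) ^ n" for n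
  proof -
    obtain d where d: "d > 0" "\<And>x. x \<noteq> 0 \<Longrightarrow> norm x < d \<Longrightarrow> norm (\<psi> x) < (1 / 2) ^ n"
      using LIM_D[OF \<psi>(2), of "(1 / 2) ^ n"] by auto
    have "\<psi> ((d / real (Suc n)) *\<^sub>R x) \<le> (1 / 2) ^ n" if x: "norm x \<le> real n" for x
    proof (cases "x = 0")
      case False
      have "norm x * d < real (Suc n) * d" using d(1) x by (intro mult_strict_right_mono) auto
      then have "norm ((d / real (Suc n)) *\<^sub>R x) < d"
        using d(1) by (simp add: pos_divide_less_eq mult.commute)
      then show ?thesis using d(2)[of "(d / real (Suc n)) *\<^sub>R x"] False d(1) by simp
    qed (simp add: negative_type_0[OF \<psi>(1)])
    then show ?thesis using d(1) by (intro exI[of _ "d / real (Suc n)"]) simp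
  qed
  then obtain l where l: "\<And>n :: nat. 0 < l n"
    and small: "\<And>n x. norm x \<le> real n \<Longrightarrow> \<psi> (l n *\<^sub>R x) \<le> (1 / 2) ^ n" by metis
  have geom: "summable (\<lambda>n. (1 / 2 :: real) ^ n)" by (intro summable_geometric) simp
  have sum: "summable (\<lambda>n. \<psi> (l n *\<^sub>R x))" for x
  proof (rule summable_comparison_test_ev[OF _ geom])
    obtain N :: nat where "norm x \<le> real N" using real_arch_simple by blast
    then show "eventually (\<lambda>n. norm (\<psi> (l n *\<^sub>R x)) \<le> (1 / 2) ^ n) sequentially"
      unfolding eventually_sequentially using nn
      by (intro exI[of _ N]) (auto intro!: small)
  qed
  define \<phi> where "\<phi> x = (\<Sum>n. \<psi> (l n *\<^sub>R x))" for x
  have neg: "negative_type \<phi>"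
    unfolding \<phi>_def by (intro negative_type_suminf negative_type_dilation \<psi> sum)
  have "(\<phi> \<longlongrightarrow> 0) (at 0)"
  \<comment> \<open>The filter is trivial only for the zero space, where every limit at 0 holds;
    Tannery's theorem asks for a proper filter.\<close>
  proof (cases "at (0 :: 'a) = bot")
    case False
    have "((\<lambda>x. \<Sum>n. \<psi> (l n *\<^sub>R x)) \<longlongrightarrow> (\<Sum>n. 0)) (at 0)"
    proof (rule tannerys_theorem[THEN conjunct2, THEN conjunct2, OF _ _ geom False])
      fix n
      have "continuous_on UNIV (\<lambda>x. \<psi> (l n *\<^sub>R x))"
        by (intro continuous_on_compose2[OF negative_type_continuous[OF \<psi>]] continuous_intros) auto
      then have "isCont (\<lambda>x. \<psi> (l n *\<^sub>R x)) 0" by (simp add: continuous_on_eq_continuous_at)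
      then show "((\<lambda>x. \<psi> (l n *\<^sub>R x)) \<longlongrightarrow> 0) (at 0)"
        by (simp add: isCont_def negative_type_0[OF \<psi>(1)])
    next
      have "eventually (\<lambda>x :: 'a. norm x \<le> 1) (at 0)"
        unfolding eventually_at by (intro exI[of _ 1]) (auto simp: dist_norm)
      with eventually_ge_at_top[of "1 :: nat"]
      have "eventually (\<lambda>p. (1 :: nat) \<le> fst p \<and> norm (snd p :: 'a) \<le> 1) (at_top \<times>\<^sub>F at 0)"
        by (rule eventually_prodI)
      then show "eventually (\<lambda>(n, x). norm (\<psi> (l n *\<^sub>R x)) \<le> (1 / 2) ^ n) (at_top \<times>\<^sub>F at 0)"
      proof (rule eventually_mono, clarify)
        fix n :: nat and x :: 'a assume "1 \<le> fst (n, x)" "norm (snd (n, x)) \<le> 1"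
        then have "norm x \<le> real n" by simp
        then show "norm (\<psi> (l n *\<^sub>R x)) \<le> (1 / 2) ^ n" using small nn by simp
      qed
    qed
    then show ?thesis unfolding \<phi>_def by simp
  qed simp
  moreover have "filterlim \<phi> at_top at_infinity"
    unfolding filterlim_at_top
  proof
    fix Z :: real
    obtain N :: nat where N: "Z / \<delta> \<le> real N" using real_arch_simple by blast
    \<comment> \<open>A number above all \<open>t / l n\<close> with \<open>n < N\<close>: beyond
      norm \<open>R\<close>, each of these dilated vectors has norm at least
      \<open>t\<close>.\<close>
    define R where "R = (\<Sum>n<N. t / l n)"
    have "Z \<le> \<phi> x" if x: "R \<le> norm x" for x
    proof -
      have "\<delta> \<le> \<psi> (l n *\<^sub>R x)" if "n < N" for n
      proof (rule le)
        have "t / l n \<le> R"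
          unfolding R_def using that t l by (intro member_le_sum) (auto simp: less_imp_le)
        then have "t / l n \<le> norm x" using x by simp
        then show "t \<le> norm (l n *\<^sub>R x)" using l[of n] by (simp add: field_simps)
      qed
      then have "(\<Sum>n<N. \<delta>) \<le> (\<Sum>n<N. \<psi> (l n *\<^sub>R x))" by (intro sum_mono) simp
      also have "\<dots> \<le> \<phi> x" unfolding \<phi>_def by (intro sum_le_suminf sum) (use nn in auto)
      finally show ?thesis using N \<delta> by (simp add: field_simps)
    qed
    then show "eventually (\<lambda>x. Z \<le> \<phi> x) at_infinity"
      unfolding eventually_at_infinity by blast
  qed
  ultimately show thesis by (rule that[OF neg])
qed

lemma negative_type_power2_dilation:
  fixes \<psi> :: "'a::real_vector \<Rightarrow> real"
  assumes "negative_type \<psi>"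
  shows "\<psi> (2 ^ n *\<^sub>R x) \<le> 4 ^ n * \<psi> x"
proof (induction n)
  case (Suc n)
  have "\<psi> (2 ^ Suc n *\<^sub>R x) = \<psi> (2 ^ n *\<^sub>R x + 2 ^ n *\<^sub>R x)"
    by (simp add: scaleR_left_distrib[symmetric])
  also have "\<dots> \<le> 4 * \<psi> (2 ^ n *\<^sub>R x)" by (rule negative_type_double[OF assms])
  finally show ?case using Suc by simp
qed simp

text \<open>Dilation by \<open>2 ^ n\<close> enlarges \<open>\<psi>\<close> at most by
  \<open>4 ^ n\<close>, so the weights \<open>(1 / 8) ^ n\<close> leave a geometric series. For the
  lower bound one summand suffices: an \<open>n\<close> with \<open>2 ^ n * t\<close> above
  \<open>R\<close> gives at least \<open>(1 / 8) ^ n\<close>.\<close>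

lemma negative_type_separating:
  fixes \<psi> :: "'a::real_normed_vector \<Rightarrow> real"
  assumes \<psi>: "negative_type \<psi>" "(\<psi> \<longlongrightarrow> 0) (at 0)" and inf: "filterlim \<psi> at_top at_infinity"
  obtains \<phi> :: "'a \<Rightarrow> real"
  where "negative_type \<phi>" "(\<phi> \<longlongrightarrow> 0) (at 0)" "\<And>t. 0 < t \<Longrightarrow> \<exists>\<delta>>0. \<forall>x. t \<le> norm x \<longrightarrow> \<delta> \<le> \<phi> x"
proof -
  have nn: "0 \<le> \<psi> x" for x by (rule negative_type_nonneg[OF \<psi>(1)])
  define f where "f n x = (1 / 8) ^ n * \<psi> (2 ^ n *\<^sub>R x)" for n x
  have f0: "0 \<le> f n x" for n x by (simp add: f_def nn)
  have f_le: "f n x \<le> (1 / 2) ^ n * \<psi> x" for n x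
  proof -
    have "f n x \<le> (1 / 8) ^ n * (4 ^ n * \<psi> x)"
      unfolding f_def by (intro mult_left_mono negative_type_power2_dilation \<psi>) simp
    also have "\<dots> = (1 / 2) ^ n * \<psi> x"
      by (simp add: mult.assoc[symmetric] power_mult_distrib[symmetric])
    finally show ?thesis .
  qed
  have sums: "(\<lambda>n. (1 / 2) ^ n * \<psi> x) sums (2 * \<psi> x)" for x
    using sums_mult2[OF geometric_sums[of "1 / 2 :: real"], of "\<psi> x"] by simp
  have sum: "summable (\<lambda>n. f n x)" for x
    by (rule summable_comparison_test'[OF sums_summable[OF sums]]) (use f0 f_le in simp)
  define \<phi> where "\<phi> x = (\<Sum>n. f n x)" for x
  have neg: "negative_type \<phi>"
    unfolding \<phi>_def using sum unfolding f_def
    by (intro negative_type_suminf negative_type_scale negative_type_dilation \<psi>) simp_all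
  have \<phi>_le: "\<phi> x \<le> 2 * \<psi> x" for x
    unfolding \<phi>_def sums_unique[OF sums] by (intro suminf_le f_le sum sums_summable[OF sums])
  have lim: "(\<phi> \<longlongrightarrow> 0) (at 0)"
  proof (rule tendsto_sandwich[OF _ _ tendsto_const])
    show "((\<lambda>x. 2 * \<psi> x) \<longlongrightarrow> 0) (at 0)" using tendsto_mult[OF tendsto_const \<psi>(2), of 2] by simp
  qed (use negative_type_nonneg[OF neg] \<phi>_le in simp_all)
  have "\<exists>\<delta>>0. \<forall>x. t \<le> norm x \<longrightarrow> \<delta> \<le> \<phi> x" if t: "0 < t" for t
  proof -
    have "eventually (\<lambda>x. 1 \<le> \<psi> x) at_infinity"
      using inf unfolding filterlim_at_top by blast
    then obtain R where R: "\<And>x. R \<le> norm x \<Longrightarrow> 1 \<le> \<psi> x"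
      unfolding eventually_at_infinity by blast
    obtain n where n: "R / t < 2 ^ n" using real_arch_pow[of 2 "R / t"] by auto
    have "(1 / 8) ^ n \<le> \<phi> x" if x: "t \<le> norm x" for x
    proof -
      have "R \<le> 2 ^ n * t" using n t by (simp add: field_simps)
      also have "\<dots> \<le> norm (2 ^ n *\<^sub>R x)" using x by simp
      finally have "(1 / 8) ^ n * 1 \<le> f n x"
        unfolding f_def by (intro mult_left_mono R) simp_all
      also have "\<dots> = (\<Sum>k\<in>{n}. f k x)" by simp
      also have "\<dots> \<le> \<phi> x" unfolding \<phi>_def by (intro sum_le_suminf sum) (use f0 in auto)
      finally show ?thesis by simp
    qed
    then show ?thesis by (intro exI[of _ "(1 / 8) ^ n"]) simp
  qed
  then show thesis by (rule that[OF neg lim])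
qed

section \<open>The four conditions\<close>

lemma infinite_UNIV_real_normed_vector:
  fixes x :: "'a::real_normed_vector"
  assumes "x \<noteq> 0"
  shows "infinite (UNIV :: 'a set)"
proof
  assume "finite (UNIV :: 'a set)"
  then have "finite (range (\<lambda>c. c *\<^sub>R x))" by (rule finite_subset[rotated]) simp
  moreover have "inj (\<lambda>c. c *\<^sub>R x)" using assms by (simp add: inj_on_def)
  ultimately have "finite (UNIV :: real set)" by (rule finite_imageD)
  then show False using infinite_UNIV_char_0 by blast
qed

text \<open>Squared distances of the realised map \<open>b\<close> are values of
  \<open>\<psi>\<close>, so properness of \<open>\<psi>\<close> makes \<open>b\<close> expanding. A
  nonzero space is infinite and hence provides enough coordinates in \<open>'a ell2\<close>; for the
  zero space the zero cocycle works.\<close>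

lemma negative_type_haagerup:
  fixes X :: "'a::real_normed_vector itself" and \<psi> :: "'a \<Rightarrow> real"
  assumes sep: "separable_space (euclidean :: 'a topology)"
    and \<psi>: "negative_type \<psi>" "(\<psi> \<longlongrightarrow> 0) (at 0)" and inf: "filterlim \<psi> at_top at_infinity"
  shows "haagerup X"
proof (cases "\<exists>x :: 'a. x \<noteq> 0")
  case False
  then have triv: "x = 0" for x :: 'a by blast
  let ?\<pi> = "\<lambda>(_ :: 'a) (v :: 'a ell2). v" and ?b = "\<lambda>_ :: 'a. 0 :: 'a ell2"
  have "\<not> 1 \<le> dist a b" for a b :: 'a using triv[of a] triv[of b] by simp
  then have "expanding ?b" unfolding expanding_iff by blast
  moreover have "bornologous ?b" unfolding bornologous_iff by (intro allI exI[of _ 0]) simp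
  ultimately have "coarse_embedding ?b" by (simp add: coarse_embedding_def)
  moreover have "isometric_representation ?\<pi>"
    unfolding isometric_representation_def by (auto simp: linear_id[unfolded id_def] fun_eq_iff)
  ultimately show ?thesis
    unfolding haagerup_def haagerup_on_def strongly_continuous_def
    by (intro exI[of _ ?\<pi>] exI[of _ ?b]) simp
next
  case True
  then have infinite: "infinite (UNIV :: 'a set)" using infinite_UNIV_real_normed_vector by blast
  obtain b :: "'a \<Rightarrow> 'a ell2" where b_cont: "continuous_on UNIV b"
    and b: "\<And>x y. inner (b x) (b y) = (\<psi> x + \<psi> y - \<psi> (x - y)) / 2"
    using separable_negative_type_embedding[OF sep infinite \<psi>] by metis
  have "b 0 = 0" using b[of 0 0] by (simp add: negative_type_0[OF \<psi>(1)])
  from cocycle_representation[OF b negative_type_minus[OF \<psi>(1)] this b_cont]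
  obtain \<pi> where \<pi>: "isometric_representation \<pi>" "strongly_continuous \<pi>"
    "\<And>x y. b (x + y) = \<pi> x (b y) + b x" by blast
  have dist: "(dist (b x) (b y))\<^sup>2 = \<psi> (x - y)" for x y
    by (intro dist_sq_gram[OF _ _ b]) (simp_all add: b negative_type_0[OF \<psi>(1)])
  have "bornologous b"
    unfolding bornologous_iff
  proof
    fix t
    obtain d where d: "d > 0" "\<And>x. x \<noteq> 0 \<Longrightarrow> norm x < d \<Longrightarrow> norm (\<psi> x) < 1"
      using LIM_D[OF \<psi>(2), of 1] by auto
    have small: "\<psi> x \<le> 1" if "norm x < d" for x
      using d(2)[of x] that by (cases "x = 0") (auto simp: negative_type_0[OF \<psi>(1)])
    \<comment> \<open>\<open>n\<close> halvings bring a difference of norm at most \<open>t\<close>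
      into the ball where \<open>\<psi>\<close> is at most 1, and each doubling back costs a factor
      of at most 4.\<close>
    obtain n where n: "t / d < 2 ^ n" using real_arch_pow[of 2 "t / d"] by auto
    have "dist (b x) (b y) \<le> sqrt (4 ^ n)" if "dist x y \<le> t" for x y
    proof (rule real_le_rsqrt)
      have "\<psi> (2 ^ n *\<^sub>R ((1 / 2 ^ n) *\<^sub>R (x - y))) \<le> 4 ^ n * \<psi> ((1 / 2 ^ n) *\<^sub>R (x - y))"
        by (rule negative_type_power2_dilation[OF \<psi>(1)])
      also have "\<dots> \<le> 4 ^ n * 1"
      proof (intro mult_left_mono small)
        have "norm (x - y) < 2 ^ n * d" using that n d(1) by (simp add: dist_norm field_simps)
        then show "norm ((1 / 2 ^ n) *\<^sub>R (x - y)) < d"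
          unfolding norm_scaleR by (simp add: field_simps)
      qed simp
      finally show "(dist (b x) (b y))\<^sup>2 \<le> 4 ^ n" by (simp add: dist)
    qed
    then show "\<exists>B. \<forall>x y. dist x y \<le> t \<longrightarrow> dist (b x) (b y) \<le> B" by blast
  qed
  moreover have "expanding b"
    unfolding expanding_iff
  proof
    fix K
    have "eventually (\<lambda>x. K\<^sup>2 \<le> \<psi> x) at_infinity"
      using inf unfolding filterlim_at_top by blast
    then obtain R where R: "\<And>x. R \<le> norm x \<Longrightarrow> K\<^sup>2 \<le> \<psi> x"
      unfolding eventually_at_infinity by blast
    have "K \<le> dist (b x) (b y)" if "R \<le> dist x y" for x y
    proof (rule power2_le_imp_le)
      show "K\<^sup>2 \<le> (dist (b x) (b y))\<^sup>2"
        unfolding dist using that by (intro R) (simp add: dist_norm)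
    qed simp
    then show "\<exists>R. \<forall>x y. R \<le> dist x y \<longrightarrow> K \<le> dist (b x) (b y)" by blast
  qed
  ultimately show ?thesis
    unfolding haagerup_def haagerup_on_def coarse_embedding_def
    by (intro exI[of _ \<pi>] exI[of _ b] conjI allI \<pi> b_cont)
qed

text \<open>Properness is first converted into a positive lower bound at every scale; the
  realisation of the new function is then a uniform embedding.\<close>

lemma negative_type_uniformly_embeds:
  fixes X :: "'a::real_normed_vector itself" and \<psi> :: "'a \<Rightarrow> real"
  assumes sep: "separable_space (euclidean :: 'a topology)"
    and \<psi>: "negative_type \<psi>" "(\<psi> \<longlongrightarrow> 0) (at 0)" and inf: "filterlim \<psi> at_top at_infinity"
  shows "uniformly_embeds_into_Hilbert X"
proof (cases "\<exists>x :: 'a. x \<noteq> 0")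
  case False
  then have triv: "x = 0" for x :: 'a by blast
  have "\<not> t \<le> dist a b" if "0 < t" for a b :: 'a and t
    using triv[of a] triv[of b] that by simp
  then have "uniform_embedding (\<lambda>_ :: 'a. 0 :: 'a ell2)"
    unfolding uniform_embedding_def compression_modulus_pos_iff
    using zero_less_one by (blast intro: uniformly_continuous_on_const)
  then show ?thesis unfolding uniformly_embeds_into_Hilbert_def uniformly_embeds_def by blast
next
  case True
  then have infinite: "infinite (UNIV :: 'a set)" using infinite_UNIV_real_normed_vector by blast
  obtain \<phi> where \<phi>: "negative_type \<phi>" "(\<phi> \<longlongrightarrow> 0) (at 0)"
    and low: "\<And>t. 0 < t \<Longrightarrow> \<exists>\<delta>>0. \<forall>x :: 'a. t \<le> norm x \<longrightarrow> \<delta> \<le> \<phi> x"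
    using negative_type_separating[OF \<psi> inf] by blast
  obtain b :: "'a \<Rightarrow> 'a ell2" where b: "\<And>x y. inner (b x) (b y) = (\<phi> x + \<phi> y - \<phi> (x - y)) / 2"
    using separable_negative_type_embedding[OF sep infinite \<phi>] by metis
  have dist: "(dist (b x) (b y))\<^sup>2 = \<phi> (x - y)" for x y
    by (intro dist_sq_gram[OF _ _ b]) (simp_all add: b negative_type_0[OF \<phi>(1)])
  have "uniformly_continuous_on UNIV b"
    unfolding uniformly_continuous_on_def
  proof (intro allI impI)
    fix e :: real assume e: "0 < e"
    then obtain d where d: "d > 0" "\<And>x. x \<noteq> 0 \<Longrightarrow> norm x < d \<Longrightarrow> norm (\<phi> x) < e\<^sup>2"
      using LIM_D[OF \<phi>(2), of "e\<^sup>2"] by auto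
    have "dist (b y) (b x) < e" if "dist y x < d" for x y
    proof -
      have "(dist (b y) (b x))\<^sup>2 < e\<^sup>2"
        using d(2)[of "y - x"] that e
        by (cases "y = x") (auto simp: dist dist_norm[of y x] negative_type_0[OF \<phi>(1)])
      then show ?thesis using e by (simp add: power_less_imp_less_base)
    qed
    then show "\<exists>d>0. \<forall>x\<in>UNIV. \<forall>x'\<in>UNIV. dist x' x < d \<longrightarrow> dist (b x') (b x) < e"
      using d(1) by blast
  qed
  moreover have "0 < compression_modulus b t" if t: "0 < t" for t
    unfolding compression_modulus_pos_iff
  proof -
    obtain \<delta> where \<delta>: "0 < \<delta>" "\<And>x. t \<le> norm x \<Longrightarrow> \<delta> \<le> \<phi> x" using low[OF t] by blast
    have "sqrt \<delta> \<le> dist (b x) (b y)" if "t \<le> dist x y" for x y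
      using \<delta>(2)[of "x - y"] that by (intro real_le_lsqrt) (simp_all add: dist dist_norm[of x y])
    then show "\<exists>\<delta>>0. \<forall>x y. t \<le> dist x y \<longrightarrow> \<delta> \<le> dist (b x) (b y)"
      using \<delta>(1) by (intro exI[of _ "sqrt \<delta>"]) simp
  qed
  ultimately show ?thesis
    unfolding uniformly_embeds_into_Hilbert_def uniformly_embeds_def uniform_embedding_def by blast
qed

lemma uniformly_embeds_uncollapsed: "uniformly_embeds X H \<Longrightarrow> admits_uncollapsed_uc_map X H"
  unfolding uniformly_embeds_def admits_uncollapsed_uc_map_def uniform_embedding_def uncollapsed_def
  using zero_less_one by blast

lemma haagerup_on_coarsely_embeds: "haagerup_on X H \<Longrightarrow> coarsely_embeds X H"
  unfolding haagerup_on_def coarsely_embeds_def by blast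

text \<open>The function of negative type forgets the target \<open>H\<close>, and its realisation
  lives in \<open>'a ell2\<close>.\<close>

lemma coarsely_embeds_imp_haagerup_and_uniformly_embeds:
  fixes X :: "'a::real_normed_vector itself" and H :: "'h::real_inner itself"
  assumes "separable_space (euclidean :: 'a topology)" "coarsely_embeds X H"
  shows "haagerup X \<and> uniformly_embeds_into_Hilbert X"
proof -
  obtain \<sigma> :: "'a \<Rightarrow> 'h" where "coarse_embedding \<sigma>"
    using assms(2) unfolding coarsely_embeds_def by blast
  then obtain \<psi> :: "'a \<Rightarrow> real"
    where "negative_type \<psi>" "(\<psi> \<longlongrightarrow> 0) (at 0)" "filterlim \<psi> at_top at_infinity"
    using coarse_embedding_negative_type by blast
  then show ?thesis
    using negative_type_haagerup[OF assms(1)] negative_type_uniformly_embeds[OF assms(1)]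
    by blast
qed

lemma uncollapsed_haagerup:
  fixes X :: "'a::real_normed_vector itself" and H :: "'h::real_inner itself"
  assumes "separable_space (euclidean :: 'a topology)" "admits_uncollapsed_uc_map X H"
  shows "haagerup X"
proof -
  obtain \<sigma> :: "'a \<Rightarrow> 'h" where "uniformly_continuous_on UNIV \<sigma>" "uncollapsed \<sigma>"
    using assms(2) unfolding admits_uncollapsed_uc_map_def by blast
  then obtain \<psi> :: "'a \<Rightarrow> real" and t \<delta> where "negative_type \<psi>" "(\<psi> \<longlongrightarrow> 0) (at 0)"
    "0 < t" "0 < \<delta>" "\<And>x. t \<le> norm x \<Longrightarrow> \<delta> \<le> \<psi> x"
    using uncollapsed_negative_type by blast
  then obtain \<phi> :: "'a \<Rightarrow> real"
    where "negative_type \<phi>" "(\<phi> \<longlongrightarrow> 0) (at 0)" "filterlim \<phi> at_top at_infinity"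
    using negative_type_amplify by blast
  then show ?thesis
    using negative_type_haagerup[OF assms(1)] by blast
qed

text \<open>The last four implications show that fixing the target \<open>'a ell2\<close> loses
  nothing: a witness for any Hilbert space \<open>H\<close> can be traded for one in
  \<open>'a ell2\<close>.\<close>

theorem theorem5:
  fixes X :: "'a::banach itself" and H :: "'h::{real_inner, banach} itself"
  assumes "separable_space (euclidean :: 'a topology)"
  shows "(coarsely_embeds_into_Hilbert X \<longleftrightarrow> uniformly_embeds_into_Hilbert X) \<and>
         (uniformly_embeds_into_Hilbert X \<longleftrightarrow> admits_uncollapsed_uc_map_into_Hilbert X) \<and>
         (admits_uncollapsed_uc_map_into_Hilbert X \<longleftrightarrow> haagerup X) \<and>
         (coarsely_embeds X H \<longrightarrow> coarsely_embeds_into_Hilbert X) \<and>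
         (uniformly_embeds X H \<longrightarrow> uniformly_embeds_into_Hilbert X) \<and>
         (admits_uncollapsed_uc_map X H \<longrightarrow> admits_uncollapsed_uc_map_into_Hilbert X) \<and>
         (haagerup_on X H \<longrightarrow> haagerup X)"
proof -
  have hc: "haagerup X \<Longrightarrow> coarsely_embeds_into_Hilbert X"
    unfolding haagerup_def coarsely_embeds_into_Hilbert_def by (rule haagerup_on_coarsely_embeds)
  have cu: "coarsely_embeds_into_Hilbert X \<Longrightarrow> uniformly_embeds_into_Hilbert X"
    unfolding coarsely_embeds_into_Hilbert_def using coarsely_embeds_imp_haagerup_and_uniformly_embeds[OF assms] by blast
  have uu: "uniformly_embeds_into_Hilbert X \<Longrightarrow> admits_uncollapsed_uc_map_into_Hilbert X"
    unfolding uniformly_embeds_into_Hilbert_def admits_uncollapsed_uc_map_into_Hilbert_def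
    by (rule uniformly_embeds_uncollapsed)
  have uh: "admits_uncollapsed_uc_map_into_Hilbert X \<Longrightarrow> haagerup X"
    unfolding admits_uncollapsed_uc_map_into_Hilbert_def by (rule uncollapsed_haagerup[OF assms])
  have H: "coarsely_embeds X H \<Longrightarrow> haagerup X" "admits_uncollapsed_uc_map X H \<Longrightarrow> haagerup X"
    using coarsely_embeds_imp_haagerup_and_uniformly_embeds[OF assms, of X H] uncollapsed_haagerup[OF assms, of X H] by blast+
  show ?thesis
    using hc cu uu uh H uniformly_embeds_uncollapsed[of X H] haagerup_on_coarsely_embeds[of X H]
    by blast
qed

end
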